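(* Let $(\Omega,\mathcal{B},\mathbf{P},T)$ be an ergodic invertible measure-preserving dynamical system with observation $\sigma$-field $\mathcal{Y}\subseteq\mathcal{B}$, and suppose that $(\Omega,\mathcal{B},\mathbf{P},T)$ is conditionally weak mixing relative to $\mathcal{Y}_{-\infty,0}$. Then for every measurable loss function $\ell:U\times\Omega\to\mathbb{R}$ such that $U$ is finite and $|\ell(u,\omega)|\le\Lambda(\omega)$ for all $(u,\omega)$ with $\Lambda\in L^1(\mathbf{P})$, the mean-optimal strategy $\mathbf{\tilde u}$ is weakly pathwise optimal: for every admissible strategy $\mathbf{u}$ and every $\varepsilon>0$, $$\mathbf{P}[L_N(\mathbf{u})-L_N(\mathbf{\tilde u})\ge-\varepsilon]\xrightarrow{N\to\infty}1.$$
   Context: Setting: $(\Omega,\mathcal{B},\mathbf{P})$ is a probability space, $\mathcal{Y}\subseteq\mathcal{B}$ a sub-$\sigma$-field, $T:\Omega\to\Omega$ an invertible (bimeasurable) measure-preserving ergodic transformation, $(U,\mathcal{U})$ a measurable space of decisions. For a $\sigma$-field $\mathcal{A}$ and $k\in\mathbb{Z}$, $T^k\mathcal{A}=\{T^kA:A\in\mathcal{A}\}$. For $-\infty\le m\le n\le\infty$, $\mathcal{Y}_{m,n}=\bigvee_{k=m}^n T^{-k}\mathcal{Y}$. For $m\le n$, $\mathbb{U}_{m,n}$ is the set of $\mathcal{Y}_{m,n}$-measurable maps $u:\Omega\to U$. Loss: for $n\in\mathbb{Z}$, $\ell_n(u)(\omega)=\ell(u,T^n\omega)$; for a random decision $u:\Omega\to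 U$, $\ell_n(u)(\omega)=\ell(u(\omega),T^n\omega)$. A strategy $\mathbf{u}=(u_k)_{k\ge1}$ is admissible if $u_k\in\mathbb{U}_{0,k}$ for every $k\ge 1$. Its time-average loss over horizon $N$ is $L_N(\mathbf{u})=\frac1N\sum_{k=1}^N\ell_k(u_k)$. Mean-optimal strategy: $\mathbf{\tilde u}=(\tilde u_k)_{k\ge1}$ denotes an (arbitrary, fixed) admissible strategy such that for every $k\ge1$, $\mathbf{E}[\ell_k(\tilde u_k)|\mathcal{Y}_{0,k}]\le \mathop{\mathrm{ess\,inf}}_{u\in\mathbb{U}_{0,k}}\mathbf{E}[\ell_k(u)|\mathcal{Y}_{0,k}]+k^{-1}$ a.s. (such a strategy always exists). Conditional weak mixing: $(\Omega,\mathcal{B},\mathbf{P},T)$ is conditionally weak mixing relative to a $\sigma$-field $\mathcal{Z}\subseteq\mathcal{B}$ if for every $A,B\in\mathcal{B}$, $$\frac1N\sum_{k=1}^N\big|\mathbf{P}[A\cap T^kB|\mathcal{Z}]-\mathbf{P}[A|\mathcal{Z}]\,\mathbf{P}[T^kB|\mathcal{Z}]\big|\xrightarrow{N\to\infty}0\quad\text{in }L^1.$$ *)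

theory Defs
  imports "HOL-Probability.Probability"
begin

definition invertible_mp :: "'a measure \<Rightarrow> ('a \<Rightarrow> 'a) \<Rightarrow> bool" where
  "invertible_mp M T \<longleftrightarrow>
     T \<in> measurable M M \<and>
     bij_betw T (space M) (space M) \<and>
     inv_into (space M) T \<in> measurable M M \<and>
     distr M M T = M"

definition ergodic :: "'a measure \<Rightarrow> ('a \<Rightarrow> 'a) \<Rightarrow> bool" where
  "ergodic M T \<longleftrightarrow>
     (\<forall>A\<in>sets M. T -` A \<inter> space M = A \<longrightarrow> measure M A = 0 \<or> measure M A = 1)"

definition tpow :: "'a measure \<Rightarrow> ('a \<Rightarrow> 'a) \<Rightarrow> int \<Rightarrow> 'a \<Rightarrow> 'a" where
  "tpow M T k = (if 0 \<le> k then T ^^ nat k else inv_into (space M) T ^^ nat (- k))"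

text \<open>Sub-\<open>\<sigma>\<close>-fields are represented by measures \<open>Y\<close> with \<open>subalgebra M Y\<close>; only
  \<open>space Y\<close> and \<open>sets Y\<close> matter. The join of the \<open>\<sigma>\<close>-fields \<open>T\<^sup>-\<^sup>k Y\<close> is taken over an
  arbitrary index set \<open>K\<close> of integers, so that infinite endpoints need no extended integers:
  \<open>K = {m..n}\<close> for finite endpoints, \<open>K = {..n}\<close> when the lower endpoint is \<open>-\<infinity>\<close>.\<close>

definition obs_field :: "'a measure \<Rightarrow> ('a \<Rightarrow> 'a) \<Rightarrow> 'a measure \<Rightarrow> int set \<Rightarrow> 'a measure" where
  "obs_field M T Y K = sigma (space M) {tpow M T (- k) ` A | k A. k \<in> K \<and> A \<in> sets Y}"

abbreviation cond_prob_on :: "'a measure \<Rightarrow> 'a measure \<Rightarrow> 'a set \<Rightarrow> 'a \<Rightarrow> real" where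
  "cond_prob_on M Z A \<equiv> real_cond_exp M Z (indicator A)"

definition cond_weak_mixing :: "'a measure \<Rightarrow> ('a \<Rightarrow> 'a) \<Rightarrow> 'a measure \<Rightarrow> bool" where
  "cond_weak_mixing M T Z \<longleftrightarrow>
     (\<forall>A\<in>sets M. \<forall>B\<in>sets M.
        (\<lambda>N. \<integral>\<omega>. \<bar>(1 / real N) * (\<Sum>k=1..N.
            \<bar>cond_prob_on M Z (A \<inter> tpow M T (int k) ` B) \<omega>
              - cond_prob_on M Z A \<omega> * cond_prob_on M Z (tpow M T (int k) ` B) \<omega>\<bar>)\<bar> \<partial>M)
        \<longlonglongrightarrow> 0)"

definition is_ess_inf :: "'a measure \<Rightarrow> ('a \<Rightarrow> ereal) set \<Rightarrow> ('a \<Rightarrow> ereal) \<Rightarrow> bool" where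
  "is_ess_inf M F g \<longleftrightarrow>
     g \<in> borel_measurable M \<and>
     (\<forall>f\<in>F. AE \<omega> in M. g \<omega> \<le> f \<omega>) \<and>
     (\<forall>h\<in>borel_measurable M. (\<forall>f\<in>F. AE \<omega> in M. h \<omega> \<le> f \<omega>) \<longrightarrow> (AE \<omega> in M. h \<omega> \<le> g \<omega>))"

text \<open>A choice of version; by \<open>is_ess_inf_ess_inf\<close> and \<open>is_ess_inf_unique\<close> below it exists and is
  unique up to null sets.\<close>

definition ess_inf :: "'a measure \<Rightarrow> ('a \<Rightarrow> ereal) set \<Rightarrow> 'a \<Rightarrow> ereal" where
  "ess_inf M F = (SOME g. is_ess_inf M F g)"

definition loss_at ::
  "'a measure \<Rightarrow> ('a \<Rightarrow> 'a) \<Rightarrow> ('u \<Rightarrow> 'a \<Rightarrow> real) \<Rightarrow> int \<Rightarrow> ('a \<Rightarrow> 'u) \<Rightarrow> 'a \<Rightarrow> real" where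
  "loss_at M T l n u \<omega> = l (u \<omega>) (tpow M T n \<omega>)"

definition decisions ::
  "'a measure \<Rightarrow> ('a \<Rightarrow> 'a) \<Rightarrow> 'a measure \<Rightarrow> 'u measure \<Rightarrow> int \<Rightarrow> int \<Rightarrow> ('a \<Rightarrow> 'u) set" where
  "decisions M T Y U m n = measurable (obs_field M T Y {m..n}) U"

text \<open>Strategies are indexed by \<open>k \<ge> 1\<close>; the value at \<open>0\<close> is never used.\<close>

definition admissible ::
  "'a measure \<Rightarrow> ('a \<Rightarrow> 'a) \<Rightarrow> 'a measure \<Rightarrow> 'u measure \<Rightarrow> (nat \<Rightarrow> 'a \<Rightarrow> 'u) \<Rightarrow> bool" where
  "admissible M T Y U u \<longleftrightarrow> (\<forall>k\<ge>1. u k \<in> decisions M T Y U 0 (int k))"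

definition avg_loss ::
  "'a measure \<Rightarrow> ('a \<Rightarrow> 'a) \<Rightarrow> ('u \<Rightarrow> 'a \<Rightarrow> real) \<Rightarrow> (nat \<Rightarrow> 'a \<Rightarrow> 'u) \<Rightarrow> nat \<Rightarrow> 'a \<Rightarrow> real" where
  "avg_loss M T l u N \<omega> = (1 / real N) * (\<Sum>k=1..N. loss_at M T l (int k) (u k) \<omega>)"

definition cond_loss ::
  "'a measure \<Rightarrow> ('a \<Rightarrow> 'a) \<Rightarrow> 'a measure \<Rightarrow> ('u \<Rightarrow> 'a \<Rightarrow> real) \<Rightarrow> nat \<Rightarrow> ('a \<Rightarrow> 'u) \<Rightarrow> 'a \<Rightarrow> real" where
  "cond_loss M T Y l k u = real_cond_exp M (obs_field M T Y {0..int k}) (loss_at M T l (int k) u)"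

definition mean_optimal ::
  "'a measure \<Rightarrow> ('a \<Rightarrow> 'a) \<Rightarrow> 'a measure \<Rightarrow> 'u measure \<Rightarrow> ('u \<Rightarrow> 'a \<Rightarrow> real) \<Rightarrow>
     (nat \<Rightarrow> 'a \<Rightarrow> 'u) \<Rightarrow> bool" where
  "mean_optimal M T Y U l ut \<longleftrightarrow>
     admissible M T Y U ut \<and>
     (\<forall>k\<ge>1. AE \<omega> in M.
        ereal (cond_loss M T Y l k (ut k) \<omega>)
          \<le> ess_inf M {\<lambda>\<omega>'. ereal (cond_loss M T Y l k u \<omega>') | u. u \<in> decisions M T Y U 0 (int k)} \<omega>
             + ereal (1 / real k))"

definition weakly_pathwise_optimal ::
  "'a measure \<Rightarrow> ('a \<Rightarrow> 'a) \<Rightarrow> 'a measure \<Rightarrow> 'u measure \<Rightarrow> ('u \<Rightarrow> 'a \<Rightarrow> real) \<Rightarrow>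
     (nat \<Rightarrow> 'a \<Rightarrow> 'u) \<Rightarrow> bool" where
  "weakly_pathwise_optimal M T Y U l us \<longleftrightarrow>
     admissible M T Y U us \<and>
     (\<forall>u. admissible M T Y U u \<longrightarrow>
       (\<forall>\<epsilon>>0. (\<lambda>N. measure M {\<omega> \<in> space M. avg_loss M T l u N \<omega> - avg_loss M T l us N \<omega> \<ge> - \<epsilon>})
                \<longlonglongrightarrow> 1))"

lemma tpow_measurable:
  assumes "invertible_mp M T"
  shows "tpow M T k \<in> measurable M M"
  using assms unfolding invertible_mp_def tpow_def by (auto intro: measurable_compose_n)

lemma tpow_image:
  assumes T: "invertible_mp M T" and A: "A \<in> sets M"
  shows "tpow M T k ` A = tpow M T (- k) -` A \<inter> space M"
proof -
  let ?S = "inv_into (space M) T"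
  have b: "bij_betw T (space M) (space M)" using T by (simp add: invertible_mp_def)
  have TS: "T (?S x) = x" and ST: "?S (T x) = x" and Tin: "T x \<in> space M" and Sin: "?S x \<in> space M"
    if "x \<in> space M" for x
    using b that by (auto simp: bij_betw_def f_inv_into_f intro: inv_into_into)
  have Tn: "(T ^^ n) x \<in> space M" and Sn: "(?S ^^ n) x \<in> space M" if "x \<in> space M" for x n
    using that by (induction n) (auto simp: Tin Sin)
  have 1: "(T ^^ n) ((?S ^^ n) x) = x" if "x \<in> space M" for x n
    using that
  proof (induction n)
    case (Suc n)
    have "(T ^^ Suc n) y = (T ^^ n) (T y)" for y by (simp only: funpow_Suc_right o_def)
    then have "(T ^^ Suc n) ((?S ^^ Suc n) x) = (T ^^ n) (T (?S ((?S ^^ n) x)))" by simp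
    also have "\<dots> = (T ^^ n) ((?S ^^ n) x)" using Suc.prems by (simp only: TS Sn)
    finally show ?case using Suc by simp
  qed simp
  have 2: "(?S ^^ n) ((T ^^ n) x) = x" if "x \<in> space M" for x n
    using that
  proof (induction n)
    case (Suc n)
    have "(?S ^^ Suc n) y = (?S ^^ n) (?S y)" for y by (simp only: funpow_Suc_right o_def)
    then have "(?S ^^ Suc n) ((T ^^ Suc n) x) = (?S ^^ n) (?S (T ((T ^^ n) x)))" by simp
    also have "\<dots> = (?S ^^ n) ((T ^^ n) x)" using Suc.prems by (simp only: ST Tn)
    finally show ?case using Suc by simp
  qed simp
  have sub: "\<And>x. x \<in> A \<Longrightarrow> x \<in> space M" using sets.sets_into_space[OF A] by auto
  have img: "f ` A = g -` A \<inter> space M"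
    if "\<And>x. x \<in> space M \<Longrightarrow> f x \<in> space M \<and> g (f x) = x"
       "\<And>x. x \<in> space M \<Longrightarrow> g x \<in> space M \<and> f (g x) = x" for f g :: "'a \<Rightarrow> 'a"
    using that sub by (auto simp: image_iff) metis
  show ?thesis
  proof (cases "k = 0")
    case True
    then show ?thesis using sub by (auto simp: tpow_def)
  next
    case False
    show ?thesis
      by (rule img) (use False in \<open>auto simp: tpow_def 1 2 Tn Sn\<close>)
  qed
qed

lemma subalgebra_obs_field:
  assumes T: "invertible_mp M T" and Y: "subalgebra M Y"
  shows "subalgebra M (obs_field M T Y K)"
proof -
  have "{tpow M T (- k) ` A | k A. k \<in> K \<and> A \<in> sets Y} \<subseteq> sets M"
  proof safe
    fix k A assume "A \<in> sets Y"
    then have "A \<in> sets M" using Y by (auto simp: subalgebra_def)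
    then show "tpow M T (- k) ` A \<in> sets M"
      using tpow_image[OF T] measurable_sets[OF tpow_measurable[OF T]] by metis
  qed
  then show ?thesis
    unfolding subalgebra_def obs_field_def
    by (auto simp: sets_measure_of_conv space_measure_of_conv split: if_splits
             intro: sets.sigma_sets_subset[THEN subsetD])
qed

lemma ess_union:
  assumes "finite_measure M" and S: "\<S> \<subseteq> sets M"
  shows "\<exists>C\<subseteq>\<S>. countable C \<and> (\<forall>A\<in>\<S>. AE \<omega> in M. \<omega> \<in> A \<longrightarrow> \<omega> \<in> \<Union>C)"
proof -
  interpret finite_measure M by fact
  define V where "V = {measure M (\<Union>C) | C. C \<subseteq> \<S> \<and> countable C}"
  have bdd: "bdd_above V" unfolding V_def bdd_above_def using bounded_measure by blast
  have ne: "V \<noteq> {}" unfolding V_def by blast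
  have "\<exists>C\<subseteq>\<S>. countable C \<and> Sup V - 1 / real (Suc n) < measure M (\<Union>C)" for n
    using less_cSup_iff[OF ne bdd, of "Sup V - 1 / real (Suc n)"] unfolding V_def by auto
  then obtain C where C: "\<And>n. C n \<subseteq> \<S>" "\<And>n. countable (C n)"
    "\<And>n. Sup V - 1 / real (Suc n) < measure M (\<Union>(C n))" by metis
  define D where "D = (\<Union>n. C n)"
  have D: "D \<subseteq> \<S>" "countable D" using C unfolding D_def by auto
  have mD: "\<Union>D \<in> sets M" using D S by (intro sets.countable_Union) auto
  have ge: "Sup V \<le> measure M (\<Union>D)"
  proof (rule field_le_epsilon)
    fix e :: real assume "0 < e"
    then obtain n where n: "1 / real (Suc n) < e" using nat_approx_posE by blast
    have "measure M (\<Union>(C n)) \<le> measure M (\<Union>D)"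
      by (rule finite_measure_mono) (use mD in \<open>auto simp: D_def\<close>)
    then show "Sup V \<le> measure M (\<Union>D) + e" using C(3)[of n] n by linarith
  qed
  have "AE \<omega> in M. \<omega> \<in> A \<longrightarrow> \<omega> \<in> \<Union>D" if A: "A \<in> \<S>" for A
  proof -
    have mA: "A \<in> sets M" using A S by auto
    have "measure M (\<Union>(insert A D)) \<le> Sup V"
    proof (rule cSup_upper[OF _ bdd])
      have "insert A D \<subseteq> \<S>" "countable (insert A D)" using A D by auto
      then show "measure M (\<Union>(insert A D)) \<in> V" unfolding V_def by blast
    qed
    moreover have "measure M (\<Union>(insert A D)) = measure M (\<Union>D) + measure M (A - \<Union>D)"
      using finite_measure_Union[of "\<Union>D" "A - \<Union>D"] mA mD by (simp add: Un_commute)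
    ultimately have "measure M (A - \<Union>D) = 0" using ge measure_nonneg[of M "A - \<Union>D"] by linarith
    then have "A - \<Union>D \<in> null_sets M"
      using mA mD by (auto simp: emeasure_eq_measure null_sets_def)
    then have "AE \<omega> in M. \<omega> \<notin> A - \<Union>D" by (rule AE_not_in)
    then show ?thesis by eventually_elim auto
  qed
  then show ?thesis using D by blast
qed

lemma is_ess_inf_exists:
  assumes M: "finite_measure M" and F: "F \<subseteq> borel_measurable M"
  shows "\<exists>g. is_ess_inf M F g"
proof -
  define L where "L q f = {\<omega> \<in> space M. f \<omega> < ereal (of_rat q)}" for q and f :: "'a \<Rightarrow> ereal"
  have "\<exists>C\<subseteq>F. countable C \<and> (\<forall>f\<in>F. AE \<omega> in M. \<omega> \<in> L q f \<longrightarrow> (\<exists>c\<in>C. \<omega> \<in> L q c))"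
    (is "\<exists>C. ?P q C") for q
  proof -
    have "L q ` F \<subseteq> sets M"
      using F unfolding L_def by (auto intro!: borel_measurable_less)
    from ess_union[OF M this] obtain C where C: "C \<subseteq> L q ` F" "countable C"
      "\<forall>A\<in>L q ` F. AE \<omega> in M. \<omega> \<in> A \<longrightarrow> \<omega> \<in> \<Union>C" by blast
    then obtain C' where C': "C' \<subseteq> F" "countable C'" "C = L q ` C'"
      by (meson countable_subset_image)
    then show ?thesis using C(3) by (intro exI[of _ C']) auto
  qed
  then have "\<forall>q. \<exists>C. ?P q C" ..
  from choice[OF this] obtain C where "\<forall>q. ?P q (C q)" ..
  then have C: "\<And>q. C q \<subseteq> F" "\<And>q. countable (C q)"
    "\<And>q f. f \<in> F \<Longrightarrow> AE \<omega> in M. \<omega> \<in> L q f \<longrightarrow> (\<exists>c\<in>C q. \<omega> \<in> L q c)" by simp_all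
  define D where "D = (\<Union>q. C q)"
  have D: "D \<subseteq> F" "countable D" using C by (auto simp: D_def)
  define g where "g \<omega> = (INF f\<in>D. f \<omega>)" for \<omega>
  have "g \<in> borel_measurable M"
    unfolding g_def using D F by (intro borel_measurable_INF) auto
  moreover have "AE \<omega> in M. g \<omega> \<le> f \<omega>" if f: "f \<in> F" for f
  proof -
    have "AE \<omega> in M. \<forall>q. \<omega> \<in> L q f \<longrightarrow> (\<exists>c\<in>C q. \<omega> \<in> L q c)"
      using C(3)[OF f] by (simp add: AE_all_countable)
    with AE_space show ?thesis
    proof (eventually_elim)
      case (elim \<omega>)
      show ?case
      proof (rule ccontr)
        assume "\<not> g \<omega> \<le> f \<omega>"
        then obtain r where r: "f \<omega> < ereal r" "ereal r < g \<omega>"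
          using ereal_dense2 by (metis not_le)
        obtain s where s: "ereal r < ereal s" "ereal s < g \<omega>"
          using r(2) ereal_dense2 by metis
        obtain q where q: "r < of_rat q" "of_rat q < s"
          using s(1) of_rat_dense by auto
        have "f \<omega> < ereal (of_rat q)" using r(1) q(1) by (meson less_ereal.simps(1) order.strict_trans)
        then have "\<omega> \<in> L q f" using elim(1) by (simp add: L_def)
        then obtain c where c: "c \<in> C q" "c \<omega> < ereal (of_rat q)" using elim(2) by (auto simp: L_def)
        have "g \<omega> \<le> c \<omega>" unfolding g_def by (rule INF_lower) (use c in \<open>auto simp: D_def\<close>)
        also have "\<dots> < ereal s" using c(2) q(2) by (meson less_ereal.simps(1) order.strict_trans)
        finally show False using s(2) by simp
      qed
    qed
  qed
  moreover have "AE \<omega> in M. h \<omega> \<le> g \<omega>" if "\<forall>f\<in>F. AE \<omega> in M. h \<omega> \<le> f \<omega>" for h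
  proof -
    have "AE \<omega> in M. \<forall>f\<in>D. h \<omega> \<le> f \<omega>"
      using that D by (subst AE_ball_countable) auto
    then show ?thesis by eventually_elim (auto simp: g_def intro: INF_greatest)
  qed
  ultimately show ?thesis unfolding is_ess_inf_def by blast
qed

lemma is_ess_inf_ess_inf:
  assumes "finite_measure M" and "F \<subseteq> borel_measurable M"
  shows "is_ess_inf M F (ess_inf M F)"
  unfolding ess_inf_def using is_ess_inf_exists[OF assms] by (rule someI_ex)

lemma is_ess_inf_unique:
  assumes "is_ess_inf M F g" and "is_ess_inf M F h"
  shows "AE \<omega> in M. g \<omega> = h \<omega>"
proof -
  have "AE \<omega> in M. g \<omega> \<le> h \<omega>" "AE \<omega> in M. h \<omega> \<le> g \<omega>"
    using assms unfolding is_ess_inf_def by blast+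
  then show ?thesis by eventually_elim auto
qed

end

(* With Z the \<sigma>-field of the past observations and g = 1_A - P[A|Z], the second moment of an average
   of terms a_k g(T^k), where a_k is bounded by 1 and observable at time k, is at most 2/N times the
   sum over m \<le> N of c_m = E|E[g g(T^-m) | Z]|: shifting by the later of the two times makes both
   weights Z-measurable. Conditional weak mixing says that c_m tends to 0 in Cesaro mean. Levy's upward
   theorem allows replacing P[T^-k A | Y_{0,k}] by P[A|Z](T^k), and density of simple functions extends
   the result from indicators to integrable losses. So for every admissible strategy the time-average
   loss is L1-close to the time average of its conditional losses, and these the mean-optimal strategy
   minimises up to 1/k. *)

theory Submission
  imports Defs
begin

text \<open>The weights a_k come from an arbitrary strategy, so the terms a_k g(T^k) are not
  stationary and pointwise ergodic theorems do not apply to them; a second moment bound that is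
  independent of the weights replaces such a theorem. Working in L1 throughout yields optimality in
  probability. The natural centring of 1_A(T^k) is its conditional expectation given Y_{0,k}, but
  that function changes with k. Centring at P[A|Z](T^k) instead shifts one fixed g, so the
  covariances are controlled by the lag alone; Levy's theorem is the price of this choice. Weak
  mixing speaks of pairs of events while g contains P[A|Z], so it is first extended to integrable
  functions in one of its two arguments. Finiteness of U produces the weights: the loss of a random
  decision is a finite sum of functions of the decision times losses of fixed decisions.\<close>

section \<open>Limits, uniform approximation and seminorms on L1\<close>

lemma cesaro_mean_tendsto_zero:
  fixes x :: "nat \<Rightarrow> real"
  assumes "x \<longlonglongrightarrow> 0"
  shows "(\<lambda>N. 1 / real N * (\<Sum>k=1..N. x k)) \<longlonglongrightarrow> 0"
proof (rule LIMSEQ_I)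
  fix e :: real assume e: "0 < e"
  obtain K where K: "\<bar>x k\<bar> < e / 2" if "K \<le> k" for k
    using LIMSEQ_D[OF assms, of "e / 2"] e by auto
  define B where "B = (\<Sum>k=1..K. \<bar>x k\<bar>)"
  have bd: "\<bar>\<Sum>k=1..N. x k\<bar> \<le> B + real N * (e / 2)" for N
  proof -
    have "\<bar>\<Sum>k=1..N. x k\<bar> \<le> (\<Sum>k=1..N. \<bar>x k\<bar>)" by (rule sum_abs)
    also have "\<dots> \<le> (\<Sum>k=1..N. (if k \<le> K then \<bar>x k\<bar> else 0) + e / 2)"
      by (rule sum_mono) (use K e in \<open>auto simp: not_le intro: less_imp_le\<close>)
    also have "\<dots> = (\<Sum>k\<in>{1..N} \<inter> {k. k \<le> K}. \<bar>x k\<bar>) + real N * (e / 2)"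
      by (simp add: sum.distrib sum.inter_restrict)
    also have "(\<Sum>k\<in>{1..N} \<inter> {k. k \<le> K}. \<bar>x k\<bar>) \<le> B"
      unfolding B_def by (rule sum_mono2) auto
    finally show ?thesis by simp
  qed
  obtain N0 :: nat where N0: "2 * B / e < N0" using reals_Archimedean2 by blast
  have "norm (1 / real N * (\<Sum>k=1..N. x k) - 0) < e" if N: "Suc N0 \<le> N" for N
  proof -
    have "2 * B / e < N" using N0 N by linarith
    then have "B < real N * (e / 2)" using e by (simp add: field_simps)
    then have "\<bar>\<Sum>k=1..N. x k\<bar> < real N * e" using bd[of N] by simp
    then show ?thesis using N by (simp add: field_simps abs_mult)
  qed
  then show "\<exists>N0. \<forall>N\<ge>N0. norm (1 / real N * (\<Sum>k=1..N. x k) - 0) < e" by blast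
qed

text \<open>Dominated convergence, in the form in which the limit case of
  \<open>integrable_induct\<close> supplies its data: the bound \<open>2 * norm (f x)\<close> on the
  approximants gives the majorant \<open>3 * \<bar>f x\<bar>\<close> of the error.\<close>

lemma integral_abs_diff_tendsto_zero:
  fixes s :: "nat \<Rightarrow> 'a \<Rightarrow> real"
  assumes [measurable]: "\<And>i. integrable M (s i)" "integrable M f"
    and lim: "\<And>x. x \<in> space M \<Longrightarrow> (\<lambda>i. s i x) \<longlonglongrightarrow> f x"
    and bd: "\<And>i x. x \<in> space M \<Longrightarrow> norm (s i x) \<le> 2 * norm (f x)"
  shows "(\<lambda>i. \<integral>x. \<bar>f x - s i x\<bar> \<partial>M) \<longlonglongrightarrow> 0"
proof -
  have [measurable]: "s i \<in> borel_measurable M" "f \<in> borel_measurable M" for i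
    using assms by auto
  have "(\<lambda>i. \<integral>x. \<bar>f x - s i x\<bar> \<partial>M) \<longlonglongrightarrow> (\<integral>x. 0 \<partial>M)"
  proof (rule integral_dominated_convergence[where w = "\<lambda>x. 3 * \<bar>f x\<bar>"])
    show "AE x in M. (\<lambda>i. \<bar>f x - s i x\<bar>) \<longlonglongrightarrow> 0"
    proof (rule AE_I2)
      fix x assume "x \<in> space M"
      from tendsto_diff[OF tendsto_const lim[OF this], of "f x"]
      show "(\<lambda>i. \<bar>f x - s i x\<bar>) \<longlonglongrightarrow> 0" by (simp add: tendsto_rabs_zero)
    qed
    show "AE x in M. norm \<bar>f x - s i x\<bar> \<le> 3 * \<bar>f x\<bar>" for i
    proof (rule AE_I2)
      fix x assume "x \<in> space M"
      from bd[OF this, of i] show "norm \<bar>f x - s i x\<bar> \<le> 3 * \<bar>f x\<bar>" by simp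
    qed
  qed (use assms in auto)
  then show ?thesis by simp
qed

lemma tendsto_zero_squeeze:
  fixes a b :: "nat \<Rightarrow> real"
  assumes "\<And>n. 0 \<le> a n" "\<And>n. a n \<le> b n" "b \<longlonglongrightarrow> 0"
  shows "a \<longlonglongrightarrow> 0"
  by (rule tendsto_sandwich[OF _ _ tendsto_const assms(3)]) (simp_all add: assms)

text \<open>The error \<open>c i\<close> is uniform in \<open>n\<close>, so \<open>i\<close> can be
  fixed before \<open>n\<close> tends to infinity.\<close>

lemma tendsto_zero_by_approximation:
  fixes a :: "nat \<Rightarrow> real"
  assumes nonneg: "\<And>n. 0 \<le> a n" and le: "\<And>i n. a n \<le> b i n + c i"
    and b: "\<And>i. b i \<longlonglongrightarrow> 0" and c: "(c :: nat \<Rightarrow> real) \<longlonglongrightarrow> 0"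
  shows "a \<longlonglongrightarrow> 0"
proof (rule LIMSEQ_I)
  fix e :: real assume e: "0 < e"
  obtain i where i: "\<bar>c i\<bar> < e / 2" using LIMSEQ_D[OF c, of "e / 2"] e by auto
  obtain K where K: "\<bar>b i n\<bar> < e / 2" if "K \<le> n" for n
    using LIMSEQ_D[OF b[of i], of "e / 2"] e by auto
  have "norm (a n - 0) < e" if "K \<le> n" for n
    using K[OF that] i nonneg[of n] le[of n i] by simp
  then show "\<exists>K. \<forall>n\<ge>K. norm (a n - 0) < e" by blast
qed

text \<open>The common density argument. Since \<open>C\<close> is the same for every
  \<open>n\<close>, the functions on which the seminorms tend to zero form a closed subspace of L1;
  containing the indicators of finite measure, it is everything. It serves for Levy's theorem, for
  the extension of weak mixing, and for the averages with adapted weights.\<close>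

lemma seminorms_vanish:
  fixes p :: "nat \<Rightarrow> ('a \<Rightarrow> real) \<Rightarrow> real"
  assumes nonneg: "\<And>n f. 0 \<le> p n f"
    and add: "\<And>n f g. integrable M f \<Longrightarrow> integrable M g \<Longrightarrow> p n (\<lambda>x. f x + g x) \<le> p n f + p n g"
    and scale: "\<And>n c f. integrable M f \<Longrightarrow> p n (\<lambda>x. c * f x) \<le> \<bar>c\<bar> * p n f"
    and bound: "\<And>n f. integrable M f \<Longrightarrow> p n f \<le> C * (\<integral>x. \<bar>f x\<bar> \<partial>M)"
    and ind: "\<And>A. A \<in> sets M \<Longrightarrow> emeasure M A < \<infinity> \<Longrightarrow> (\<lambda>n. p n (indicator A)) \<longlonglongrightarrow> 0"
    and f: "integrable M f"
  shows "(\<lambda>n. p n f) \<longlonglongrightarrow> 0"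
  using f
proof (induction rule: integrable_induct)
  case (base A c)
  have i: "integrable M (indicator A :: _ \<Rightarrow> real)" using base by (simp add: integrable_indicator_iff)
  have "p n (\<lambda>x. indicator A x *\<^sub>R c) \<le> \<bar>c\<bar> * p n (indicator A)" for n
    using scale[OF i, of n c] by (simp add: mult.commute)
  moreover have "(\<lambda>n. \<bar>c\<bar> * p n (indicator A)) \<longlonglongrightarrow> 0"
    using tendsto_mult_right_zero[OF ind[OF base]] .
  ultimately show ?case
    by (rule tendsto_zero_squeeze[OF nonneg])
next
  case (add f g)
  show ?case
    by (rule tendsto_zero_squeeze[OF nonneg assms(2) tendsto_add_zero]) (rule add)+
next
  case (lim f s)
  have c: "(\<lambda>i. C * (\<integral>x. \<bar>f x - s i x\<bar> \<partial>M)) \<longlonglongrightarrow> 0"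
    by (intro tendsto_mult_right_zero integral_abs_diff_tendsto_zero) (use lim in auto)
  show ?case
  proof (rule tendsto_zero_by_approximation[OF nonneg _ lim.IH c])
    fix i n
    have "p n (\<lambda>x. s i x + (f x - s i x)) \<le> p n (s i) + p n (\<lambda>x. f x - s i x)"
      by (intro assms(2)) (use lim in auto)
    also have "\<dots> \<le> p n (s i) + C * (\<integral>x. \<bar>f x - s i x\<bar> \<partial>M)"
      using bound[of "\<lambda>x. f x - s i x" n] lim by simp
    finally show "p n f \<le> p n (s i) + C * (\<integral>x. \<bar>f x - s i x\<bar> \<partial>M)" by simp
  qed
qed

text \<open>Conditional expectations are linear only almost everywhere, and the null set depends on
  the arguments; hence additivity of \<open>L\<close> is assumed just for the given pair
  \<open>f\<close>, \<open>g\<close>.\<close>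

lemma integral_abs_additive_le:
  fixes L :: "('a \<Rightarrow> real) \<Rightarrow> 'a \<Rightarrow> real"
  assumes "integrable M (L f)" "integrable M (L g)" "integrable M (L (\<lambda>x. f x + g x))"
    and "AE x in M. L (\<lambda>x. f x + g x) x = L f x + L g x"
  shows "(\<integral>x. \<bar>L (\<lambda>x. f x + g x) x\<bar> \<partial>M) \<le> (\<integral>x. \<bar>L f x\<bar> \<partial>M) + (\<integral>x. \<bar>L g x\<bar> \<partial>M)"
proof -
  have "(\<integral>x. \<bar>L (\<lambda>x. f x + g x) x\<bar> \<partial>M) \<le> (\<integral>x. \<bar>L f x\<bar> + \<bar>L g x\<bar> \<partial>M)"
    by (rule integral_mono_AE) (use assms in auto)
  then show ?thesis using assms by simp
qed

lemma integral_abs_homogeneous: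
  fixes L :: "('a \<Rightarrow> real) \<Rightarrow> 'a \<Rightarrow> real"
  assumes "integrable M (L f)" "integrable M (L (\<lambda>x. c * f x))"
    and "AE x in M. L (\<lambda>x. c * f x) x = c * L f x"
  shows "(\<integral>x. \<bar>L (\<lambda>x. c * f x) x\<bar> \<partial>M) = \<bar>c\<bar> * (\<integral>x. \<bar>L f x\<bar> \<partial>M)"
proof -
  have "(\<integral>x. \<bar>L (\<lambda>x. c * f x) x\<bar> \<partial>M) = (\<integral>x. \<bar>c\<bar> * \<bar>L f x\<bar> \<partial>M)"
    by (rule integral_cong_AE) (use assms in \<open>auto simp: abs_mult\<close>)
  then show ?thesis by simp
qed

section \<open>Conditional expectation as a contraction of L1\<close>

context sigma_finite_subalgebra
begin

lemma real_cond_exp_abs_le: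
  assumes "integrable M f"
  shows "AE x in M. \<bar>real_cond_exp M F f x\<bar> \<le> real_cond_exp M F (\<lambda>x. \<bar>f x\<bar>) x"
proof -
  have "AE x in M. real_cond_exp M F f x \<le> real_cond_exp M F (\<lambda>x. \<bar>f x\<bar>) x"
    by (rule real_cond_exp_mono) (use assms in auto)
  moreover have "AE x in M. real_cond_exp M F (\<lambda>x. - 1 * f x) x \<le> real_cond_exp M F (\<lambda>x. \<bar>f x\<bar>) x"
    by (rule real_cond_exp_mono) (use assms in auto)
  moreover have "AE x in M. real_cond_exp M F (\<lambda>x. - 1 * f x) x = - 1 * real_cond_exp M F f x"
    by (rule real_cond_exp_cmult[OF assms])
  ultimately show ?thesis by eventually_elim auto
qed

lemma real_cond_exp_contraction:
  assumes "integrable M f"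
  shows "(\<integral>x. \<bar>real_cond_exp M F f x\<bar> \<partial>M) \<le> (\<integral>x. \<bar>f x\<bar> \<partial>M)"
proof -
  have "(\<integral>x. \<bar>real_cond_exp M F f x\<bar> \<partial>M) \<le> (\<integral>x. real_cond_exp M F (\<lambda>x. \<bar>f x\<bar>) x \<partial>M)"
    by (rule integral_mono_AE[OF _ _ real_cond_exp_abs_le])
      (use assms in \<open>auto intro: real_cond_exp_int\<close>)
  also have "\<dots> = (\<integral>x. \<bar>f x\<bar> \<partial>M)" by (rule real_cond_exp_int) (use assms in auto)
  finally show ?thesis .
qed

end

lemma (in prob_space) sigma_finite_subalgebraI:
  "subalgebra M F \<Longrightarrow> sigma_finite_subalgebra M F"
  by (intro finite_measure_subalgebra_is_sigma_finite finite_measure_subalgebra.intro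
      finite_measure_subalgebra_axioms.intro finite_measure_axioms)

text \<open>Nonnegativity of the variance of |X|, that is, Cauchy-Schwarz against the constant
  1.\<close>

lemma (in prob_space) expectation_abs_le_sqrt:
  fixes X :: "'a \<Rightarrow> real"
  assumes "integrable M X" "integrable M (\<lambda>x. (X x)\<^sup>2)"
  shows "expectation (\<lambda>x. \<bar>X x\<bar>) \<le> sqrt (expectation (\<lambda>x. (X x)\<^sup>2))"
proof -
  have "variance (\<lambda>x. \<bar>X x\<bar>) = expectation (\<lambda>x. \<bar>X x\<bar>\<^sup>2) - (expectation (\<lambda>x. \<bar>X x\<bar>))\<^sup>2"
    by (rule variance_eq) (use assms in auto)
  moreover have "variance (\<lambda>x. \<bar>X x\<bar>) \<ge> 0" by (rule variance_positive)
  ultimately show ?thesis by (intro real_le_rsqrt) simp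
qed

section \<open>Levy's upward theorem in L1\<close>

text \<open>Convergence in mean needs no maximal inequality. The L1 distances from f to E[f|F n] are
  seminorms bounded by twice the norm of f; on an event of \<open>F m\<close> they vanish from
  \<open>m\<close> on, and a Dynkin system argument passes from these events to all of
  \<open>Z\<close>.\<close>

lemma (in prob_space) levy_upward_L1:
  fixes f :: "'a \<Rightarrow> real"
  assumes F: "\<And>n. subalgebra M (F n)" and mono: "\<And>m n. m \<le> n \<Longrightarrow> sets (F m) \<subseteq> sets (F n)"
    and Z: "subalgebra M Z" "sets Z = sigma_sets (space M) (\<Union>n. sets (F n))"
    and f: "integrable M f" "f \<in> borel_measurable Z"
  shows "(\<lambda>n. \<integral>x. \<bar>f x - real_cond_exp M (F n) f x\<bar> \<partial>M) \<longlonglongrightarrow> 0"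
proof -
  let ?Z = "restr_to_subalg M Z"
  let ?p = "\<lambda>n f. \<integral>x. \<bar>f x - real_cond_exp M (F n) f x\<bar> \<partial>M"
  have sf: "sigma_finite_subalgebra M (F n)" for n by (intro sigma_finite_subalgebraI F)
  have iM: "integrable M g" if "integrable ?Z g" for g :: "'a \<Rightarrow> real"
    using integrable_from_subalg[OF Z(1) that] .
  have ce: "integrable M (real_cond_exp M (F n) g)" if "integrable M g" for g n
    using sigma_finite_subalgebra.real_cond_exp_int(1)[OF sf that] .
  have iL: "integrable M (\<lambda>x. f x - real_cond_exp M (F n) f x)" if "integrable M f" for f n
    using that ce[OF that] by simp
  have padd: "?p n (\<lambda>x. f x + g x) \<le> ?p n f + ?p n g" if fg: "integrable M f" "integrable M g" for f g n
  proof (rule integral_abs_additive_le[where L = "\<lambda>f x. f x - real_cond_exp M (F n) f x"])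
    show "AE x in M. f x + g x - real_cond_exp M (F n) (\<lambda>x. f x + g x) x
        = f x - real_cond_exp M (F n) f x + (g x - real_cond_exp M (F n) g x)"
      using sigma_finite_subalgebra.real_cond_exp_add[OF sf fg, of n] by eventually_elim auto
  qed (intro iL Bochner_Integration.integrable_add fg)+
  have pscale: "?p n (\<lambda>x. c * f x) = \<bar>c\<bar> * ?p n f" if f: "integrable M f" for f c n
  proof (rule integral_abs_homogeneous[where L = "\<lambda>f x. f x - real_cond_exp M (F n) f x"])
    show "AE x in M. c * f x - real_cond_exp M (F n) (\<lambda>x. c * f x) x = c * (f x - real_cond_exp M (F n) f x)"
      using sigma_finite_subalgebra.real_cond_exp_cmult[OF sf f, of n c]
      by eventually_elim (simp add: right_diff_distrib)
  qed (intro iL integrable_mult_right f)+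
  have pbound: "?p n f \<le> 2 * (\<integral>x. \<bar>f x\<bar> \<partial>M)" if fg: "integrable M f" for f n
  proof -
    have "?p n f \<le> (\<integral>x. \<bar>f x\<bar> + \<bar>real_cond_exp M (F n) f x\<bar> \<partial>M)"
      by (rule integral_mono) (use fg in \<open>auto simp: ce\<close>)
    also have "\<dots> = (\<integral>x. \<bar>f x\<bar> \<partial>M) + (\<integral>x. \<bar>real_cond_exp M (F n) f x\<bar> \<partial>M)"
      by (rule Bochner_Integration.integral_add) (use fg in \<open>auto simp: ce\<close>)
    finally show ?thesis
      using sigma_finite_subalgebra.real_cond_exp_contraction[OF sf fg, of n] by simp
  qed
  have pind: "(\<lambda>n. ?p n (indicator A)) \<longlonglongrightarrow> 0" if "A \<in> sets Z" for A
  proof -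
    have inM: "B \<in> sets M" if "B \<in> sigma_sets (space M) (\<Union>n. sets (F n))" for B
      using that Z by (auto simp: subalgebra_def)
    have ii: "integrable M (indicator B :: _ \<Rightarrow> real)" if "B \<in> sigma_sets (space M) (\<Union>n. sets (F n))" for B
      using inM[OF that] by (simp add: integrable_indicator_iff emeasure_eq_measure)
    have spF: "space M \<in> sets (F n)" for n using F[of n] sets.top[of "F n"] by (auto simp: subalgebra_def)
    have base: "(\<lambda>n. ?p n (indicator B)) \<longlonglongrightarrow> 0" if B: "B \<in> sets (F m)" for B m
    proof -
      have "?p n (indicator B) = 0" if "m \<le> n" for n
      proof -
        have Bn: "B \<in> sets (F n)" using mono[OF that] B by auto
        then have i: "integrable M (indicator B :: _ \<Rightarrow> real)"
          using F[of n] by (auto simp: integrable_indicator_iff emeasure_eq_measure subalgebra_def)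
        have "AE x in M. real_cond_exp M (F n) (indicator B) x = indicator B x"
          by (rule sigma_finite_subalgebra.real_cond_exp_F_meas[OF sf i]) (use Bn in auto)
        then have "AE x in M. \<bar>indicator B x - real_cond_exp M (F n) (indicator B) x\<bar> = 0"
          by eventually_elim auto
        from integral_eq_zero_AE[OF this] show ?thesis .
      qed
      then show ?thesis by (intro tendsto_eventually eventually_sequentiallyI[of m])
    qed
    \<comment> \<open>Two events of the union lie in a common \<open>F n\<close> because the fields
      increase; so the union is a pi-system, and disjoint unions and complements suffice.\<close>
    have "Int_stable (\<Union>n. sets (F n))"
    proof (rule Int_stableI)
      fix a b assume "a \<in> (\<Union>n. sets (F n))" "b \<in> (\<Union>n. sets (F n))"
      then obtain i j where "a \<in> sets (F i)" "b \<in> sets (F j)" by auto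
      then have "a \<in> sets (F (max i j))" "b \<in> sets (F (max i j))"
        using mono[of i "max i j"] mono[of j "max i j"] by auto
      then show "a \<inter> b \<in> (\<Union>n. sets (F n))" by auto
    qed
    moreover have "(\<Union>n. sets (F n)) \<subseteq> Pow (space M)"
    proof (rule UN_least)
      show "sets (F n) \<subseteq> Pow (space M)" for n
        using F[of n] sets.space_closed[of "F n"] by (simp add: subalgebra_def)
    qed
    moreover have "A \<in> sigma_sets (space M) (\<Union>n. sets (F n))" using that unfolding Z(2) .
    ultimately show ?thesis
    proof (induction rule: sigma_sets_induct_disjoint)
      case (basic A) then show ?case using base by auto
    next
      case empty show ?case by (rule base[of _ 0]) simp
    next
      case (compl A)
      \<comment> \<open>Since \<open>space M\<close> lies in every \<open>F n\<close>, subadditivity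
        and homogeneity of the seminorms reduce the complement to \<open>A\<close> itself.\<close>
      have eq: "indicator (space M - A) = (\<lambda>x. indicator (space M) x + (- 1) * indicator A x :: real)"
        using sets.sets_into_space[OF inM[OF compl(1)]] by (auto simp: indicator_def fun_eq_iff)
      have "?p n (indicator (space M - A)) \<le> ?p n (indicator (space M)) + ?p n (indicator A)" for n
      proof -
        have "?p n (indicator (space M - A)) \<le> ?p n (indicator (space M)) + ?p n (\<lambda>x. - 1 * indicator A x)"
          unfolding eq by (rule padd) (use ii[OF compl(1)] in \<open>auto simp: emeasure_eq_measure integrable_indicator_iff\<close>)
        also have "?p n (\<lambda>x. - 1 * indicator A x) = ?p n (indicator A)"
          unfolding pscale[OF ii[OF compl(1)]] by simp
        finally show ?thesis .
      qed
      moreover have "(\<lambda>n. ?p n (indicator (space M)) + ?p n (indicator A)) \<longlonglongrightarrow> 0"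
        by (intro tendsto_add_zero base[OF spF] compl)
      ultimately show ?case
        by (rule tendsto_zero_squeeze[rotated]) simp_all
    next
      case (union A)
      define B where "B m = (\<Union>i<m. A i)" for m
      define C where "C = (\<Union>i. A i)"
      have As: "A i \<in> sigma_sets (space M) (\<Union>n. sets (F n))" for i using union by auto
      have [measurable]: "A i \<in> sets M" for i using inM[OF As] .
      have [measurable]: "B m \<in> sets M" "C \<in> sets M" for m by (auto simp: B_def C_def)
      have iB: "integrable M (indicator (B m) :: _ \<Rightarrow> real)" "integrable M (indicator C :: _ \<Rightarrow> real)" for m
        by (auto simp: emeasure_eq_measure integrable_indicator_iff)
      have pB: "(\<lambda>n. ?p n (indicator (B m))) \<longlonglongrightarrow> 0" for m
      proof (induction m)
        case 0
        have "B 0 = {}" by (simp add: B_def)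
        then show ?case by (intro base[of _ 0]) simp
      next
        case (Suc m)
        have "A m \<inter> A i = {}" if "i < m" for i
          using disjoint_family_onD[OF union(1), of m i] that by simp
        then have "A m \<inter> B m = {}" by (auto simp: B_def)
        then have eq: "indicator (B (Suc m)) = (\<lambda>x. indicator (B m) x + indicator (A m) x :: real)"
          by (auto simp: indicator_def fun_eq_iff B_def less_Suc_eq)
        have "?p n (indicator (B (Suc m))) \<le> ?p n (indicator (B m)) + ?p n (indicator (A m))" for n
          unfolding eq by (rule padd) (auto simp: emeasure_eq_measure integrable_indicator_iff)
        moreover have "(\<lambda>n. ?p n (indicator (B m)) + ?p n (indicator (A m))) \<longlonglongrightarrow> 0"
          by (intro tendsto_add_zero Suc union)
        ultimately show ?case
          by (rule tendsto_zero_squeeze[rotated]) simp_all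
      qed
      \<comment> \<open>The finite partial unions \<open>B m\<close> follow by additivity. The
        seminorm of the remaining tail is at most this quantity for all \<open>n\<close> at once, so
        \<open>m\<close> can be fixed first.\<close>
      have c: "(\<lambda>m. 2 * (\<integral>x. \<bar>indicator C x - indicator (B m) x :: real\<bar> \<partial>M)) \<longlonglongrightarrow> 0"
      proof (intro tendsto_mult_right_zero integral_abs_diff_tendsto_zero iB)
        fix x
        show "(\<lambda>m. indicator (B m) x :: real) \<longlonglongrightarrow> indicator C x"
          unfolding B_def C_def by (rule LIMSEQ_indicator_UN)
        show "norm (indicator (B m) x :: real) \<le> 2 * norm (indicator C x :: real)" for m
          by (auto simp: indicator_def B_def C_def)
      qed
      have "(\<lambda>n. ?p n (indicator C)) \<longlonglongrightarrow> 0"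
      proof (rule tendsto_zero_by_approximation[OF _ _ pB c])
        fix i n
        have "?p n (\<lambda>x. indicator (B i) x + (indicator C x - indicator (B i) x))
           \<le> ?p n (indicator (B i)) + ?p n (\<lambda>x. indicator C x - indicator (B i) x)"
          by (intro padd) (use iB in auto)
        also have "\<dots> \<le> ?p n (indicator (B i)) + 2 * (\<integral>x. \<bar>indicator C x - indicator (B i) x\<bar> \<partial>M)"
          using pbound[of "\<lambda>x. indicator C x - indicator (B i) x" n] iB by simp
        finally show "?p n (indicator C) \<le> ?p n (indicator (B i)) + 2 * (\<integral>x. \<bar>indicator C x - indicator (B i) x\<bar> \<partial>M)"
          by simp
      qed simp
      then show ?case unfolding C_def .
    qed
  qed
  \<comment> \<open>Convergence is known for the indicators of events of \<open>Z\<close> only, so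
    the density argument runs over the restriction of the measure to \<open>Z\<close>, where
    \<open>f\<close> is still integrable and the L1 norms are unchanged.\<close>
  have fZ: "integrable ?Z f" by (rule integrable_in_subalg[OF Z(1) f(2,1)])
  have absZ: "(\<integral>x. \<bar>g x\<bar> \<partial>?Z) = (\<integral>x. \<bar>g x\<bar> \<partial>M)" if "integrable ?Z g" for g :: "'a \<Rightarrow> real"
  proof (rule integral_subalgebra2[OF Z(1)])
    show "(\<lambda>x. \<bar>g x\<bar>) \<in> borel_measurable Z"
      by (rule measurable_in_subalg'[OF Z(1)]) (use that in auto)
  qed
  show ?thesis
    by (rule seminorms_vanish[where M = ?Z and p = ?p and C = 2])
      (use fZ padd pscale pbound pind sets_restr_to_subalg[OF Z(1)] absZ iM in \<open>auto simp del: abs_mult\<close>)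
qed

section \<open>Conditional covariance of an event and a function\<close>

text \<open>One argument stays an event and the other is a function, in which the expression is
  linear. Taking for \<open>g\<close> the indicator of the image of B under T^k gives the difference
  inside \<open>cond_weak_mixing\<close>.\<close>

definition cond_cov :: "'a measure \<Rightarrow> 'a measure \<Rightarrow> 'a set \<Rightarrow> ('a \<Rightarrow> real) \<Rightarrow> 'a \<Rightarrow> real" where
  "cond_cov M Z A g x =
     real_cond_exp M Z (\<lambda>x. indicator A x * g x) x - cond_prob_on M Z A x * real_cond_exp M Z g x"

context prob_space
begin

lemma integrable_indicator_mult:
  fixes g :: "'a \<Rightarrow> real"
  shows "A \<in> sets M \<Longrightarrow> integrable M g \<Longrightarrow> integrable M (\<lambda>x. indicator A x * g x)"
  using integrable_real_mult_indicator[of A M g] by (simp add: mult.commute)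

lemma integrable_indicator_prob: "A \<in> sets M \<Longrightarrow> integrable M (indicator A :: 'a \<Rightarrow> real)"
  by (simp add: integrable_indicator_iff emeasure_eq_measure)

lemma cond_prob_on_bounds:
  assumes Z: "subalgebra M Z" and A: "A \<in> sets M"
  shows "AE x in M. 0 \<le> cond_prob_on M Z A x \<and> cond_prob_on M Z A x \<le> 1"
proof -
  interpret sigma_finite_subalgebra M Z by (rule sigma_finite_subalgebraI[OF Z])
  have "AE x in M. 0 \<le> cond_prob_on M Z A x"
    by (rule real_cond_exp_ge_c) (auto intro: integrable_indicator_prob A)
  moreover have "AE x in M. cond_prob_on M Z A x \<le> 1"
    by (rule real_cond_exp_le_c) (auto intro: integrable_indicator_prob A simp: indicator_def)
  ultimately show ?thesis by eventually_elim simp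
qed

text \<open>As P[A|Z] lies in [0,1] almost everywhere, each of the two terms has L1 norm at most
  that of \<open>g\<close>. The resulting 2 is the uniform constant for
  \<open>seminorms_vanish\<close>.\<close>

lemma
  assumes Z: "subalgebra M Z" and A: "A \<in> sets M" and g: "integrable M g"
  shows integrable_cond_cov: "integrable M (cond_cov M Z A g)"
    and cond_cov_bound: "(\<integral>x. \<bar>cond_cov M Z A g x\<bar> \<partial>M) \<le> 2 * (\<integral>x. \<bar>g x\<bar> \<partial>M)"
proof -
  interpret sigma_finite_subalgebra M Z by (rule sigma_finite_subalgebraI[OF Z])
  let ?E = "real_cond_exp M Z"
  have iAg: "integrable M (\<lambda>x. indicator A x * g x)" by (rule integrable_indicator_mult[OF A g])
  have i1: "integrable M (?E (\<lambda>x. indicator A x * g x))" and i2: "integrable M (?E g)"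
    by (rule real_cond_exp_int[OF iAg] real_cond_exp_int[OF g])+
  have le: "AE x in M. \<bar>cond_prob_on M Z A x * ?E g x\<bar> \<le> \<bar>?E g x\<bar>"
    using cond_prob_on_bounds[OF Z A]
    by eventually_elim (simp add: abs_mult mult_left_le_one_le)
  have i3: "integrable M (\<lambda>x. cond_prob_on M Z A x * ?E g x)"
    by (rule Bochner_Integration.integrable_bound[OF i2]) (use le in auto)
  show "integrable M (cond_cov M Z A g)"
    unfolding cond_cov_def[abs_def] using i1 i3 by auto
  have "(\<integral>x. \<bar>cond_cov M Z A g x\<bar> \<partial>M) \<le> (\<integral>x. \<bar>?E (\<lambda>x. indicator A x * g x) x\<bar> + \<bar>?E g x\<bar> \<partial>M)"
  proof (rule integral_mono_AE)
    show "AE x in M. \<bar>cond_cov M Z A g x\<bar> \<le> \<bar>?E (\<lambda>x. indicator A x * g x) x\<bar> + \<bar>?E g x\<bar>"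
      using le by eventually_elim (auto simp: cond_cov_def)
  qed (use i1 i2 \<open>integrable M (cond_cov M Z A g)\<close> in auto)
  also have "\<dots> = (\<integral>x. \<bar>?E (\<lambda>x. indicator A x * g x) x\<bar> \<partial>M) + (\<integral>x. \<bar>?E g x\<bar> \<partial>M)"
    by (rule Bochner_Integration.integral_add) (use i1 i2 in auto)
  also have "\<dots> \<le> (\<integral>x. \<bar>indicator A x * g x\<bar> \<partial>M) + (\<integral>x. \<bar>g x\<bar> \<partial>M)"
    by (intro add_mono real_cond_exp_contraction iAg g)
  also have "(\<integral>x. \<bar>indicator A x * g x\<bar> \<partial>M) \<le> (\<integral>x. \<bar>g x\<bar> \<partial>M)"
    by (rule integral_mono) (use g iAg in \<open>auto simp: indicator_def\<close>)
  finally show "(\<integral>x. \<bar>cond_cov M Z A g x\<bar> \<partial>M) \<le> 2 * (\<integral>x. \<bar>g x\<bar> \<partial>M)" by simp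
qed

lemma cond_cov_add:
  assumes Z: "subalgebra M Z" and A: "A \<in> sets M" and f: "integrable M f" and g: "integrable M g"
  shows "AE x in M. cond_cov M Z A (\<lambda>x. f x + g x) x = cond_cov M Z A f x + cond_cov M Z A g x"
proof -
  interpret sigma_finite_subalgebra M Z by (rule sigma_finite_subalgebraI[OF Z])
  show ?thesis
    using real_cond_exp_add[OF f g]
      real_cond_exp_add[OF integrable_indicator_mult[OF A f] integrable_indicator_mult[OF A g]]
    by eventually_elim (simp add: cond_cov_def algebra_simps)
qed

lemma cond_cov_cmult:
  assumes Z: "subalgebra M Z" and A: "A \<in> sets M" and f: "integrable M f"
  shows "AE x in M. cond_cov M Z A (\<lambda>x. c * f x) x = c * cond_cov M Z A f x"
proof -
  interpret sigma_finite_subalgebra M Z by (rule sigma_finite_subalgebraI[OF Z])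
  have eq: "(\<lambda>x. indicator A x * (c * f x)) = (\<lambda>x. c * (indicator A x * f x))" by (simp add: ac_simps)
  show ?thesis
    using real_cond_exp_cmult[OF f, of c] real_cond_exp_cmult[OF integrable_indicator_mult[OF A f], of c]
    by eventually_elim (simp add: cond_cov_def eq right_diff_distrib)
qed

end

section \<open>Two-sided iterates and the observation fields\<close>

locale observed_system = prob_space M for M :: "'a measure" +
  fixes T :: "'a \<Rightarrow> 'a" and Y :: "'a measure"
  assumes inv: "invertible_mp M T" and subalgebra_Y: "subalgebra M Y"
begin

abbreviation tp :: "int \<Rightarrow> 'a \<Rightarrow> 'a" where "tp \<equiv> tpow M T"
abbreviation obs :: "int set \<Rightarrow> 'a measure" where "obs \<equiv> obs_field M T Y"

lemma tp_measurable [measurable]: "tp k \<in> measurable M M"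
  by (rule tpow_measurable[OF inv])

lemma tp_space [simp]: "x \<in> space M \<Longrightarrow> tp k x \<in> space M"
  using measurable_space[OF tp_measurable] .

lemma
  assumes "x \<in> space M"
  shows T_inv_into: "T (inv_into (space M) T x) = x" and inv_into_T: "inv_into (space M) T (T x) = x"
  using inv assms by (auto simp: invertible_mp_def bij_betw_def f_inv_into_f)

lemma tp_succ: "x \<in> space M \<Longrightarrow> tp (k + 1) x = T (tp k x)"
proof (cases "0 \<le> k")
  case True
  then have "nat (k + 1) = Suc (nat k)" by simp
  then show ?thesis using True by (simp add: tpow_def)
next
  case False
  assume x: "x \<in> space M"
  have "nat (- k) = Suc (nat (- (k + 1)))" using False by simp
  then have "tp k x = inv_into (space M) T (tp (k + 1) x)" using False by (auto simp: tpow_def)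
  then show ?thesis using T_inv_into[of "tp (k + 1) x"] x by simp
qed

lemma tp_pred: "x \<in> space M \<Longrightarrow> tp (k - 1) x = inv_into (space M) T (tp k x)"
  using tp_succ[of x "k - 1"] inv_into_T[of "tp (k - 1) x"] by simp

text \<open>The induction runs in both directions from 0 and uses that \<open>T\<close> and
  \<open>inv_into (space M) T\<close> cancel. They do so on \<open>space M\<close>, whence the
  hypothesis on \<open>x\<close>.\<close>

lemma tp_add:
  assumes x: "x \<in> space M"
  shows "tp (j + k) x = tp j (tp k x)"
proof (induction j rule: int_induct[where k = 0])
  case base show ?case by (simp add: tpow_def)
next
  case (step1 i)
  then show ?case using tp_succ[of x "i + k"] tp_succ[of "tp k x" i] x by (simp add: algebra_simps)
next
  case (step2 i)
  then show ?case using tp_pred[of x "i + k"] tp_pred[of "tp k x" i] x by (simp add: algebra_simps)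
qed

lemma tp_0 [simp]: "tp 0 x = x" by (simp add: tpow_def)

lemma tp_cancel [simp]:
  "x \<in> space M \<Longrightarrow> tp k (tp (- k) x) = x" "x \<in> space M \<Longrightarrow> tp (- k) (tp k x) = x"
  using tp_add[of x k "- k"] tp_add[of x "- k" k] by simp_all

lemma distr_tp: "distr M M (tp k) = M"
proof -
  have T: "T \<in> measurable M M" "distr M M T = M" using inv by (auto simp: invertible_mp_def)
  have pos: "distr M M (tp (int n)) = M" for n
  proof (induction n)
    case 0
    have "distr M M (tp 0) = distr M M (\<lambda>x. x)" by (rule distr_cong) auto
    then show ?case by simp
  next
    case (Suc n)
    have "distr M M (tp (int (Suc n))) = distr M M (T \<circ> tp (int n))"
      by (rule distr_cong) (use tp_succ[of _ "int n"] in \<open>auto simp: add.commute\<close>)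
    also have "\<dots> = distr (distr M M (tp (int n))) M T"
      by (rule distr_distr[symmetric]) (use T in auto)
    finally show ?case using Suc T by simp
  qed
  show ?thesis
  proof (cases "0 \<le> k")
    case True then show ?thesis using pos[of "nat k"] by simp
  next
    case False
    then have "distr M M (tp (- k)) = M" using pos[of "nat (- k)"] by simp
    \<comment> \<open>For negative \<open>k\<close>, writing M as its own image under the positive
      iterate \<open>tp (- k)\<close> lets \<open>tp k\<close> cancel it.\<close>
    then have "distr M M (tp k) = distr (distr M M (tp (- k))) M (tp k)" by simp
    also have "\<dots> = distr M M (tp k \<circ> tp (- k))" by (rule distr_distr) auto
    also have "\<dots> = distr M M (\<lambda>x. x)" by (rule distr_cong) auto
    finally show ?thesis by simp
  qed
qed

lemma integral_tp:
  fixes f :: "'a \<Rightarrow> real"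
  assumes "f \<in> borel_measurable M"
  shows "(\<integral>x. f (tp k x) \<partial>M) = (\<integral>x. f x \<partial>M)"
  using integral_distr[OF tp_measurable[of k] assms] by (simp add: distr_tp)

lemma integrable_tp:
  fixes f :: "'a \<Rightarrow> real"
  assumes "integrable M f"
  shows "integrable M (\<lambda>x. f (tp k x))"
  by (rule integrable_distr[OF tp_measurable]) (simp add: distr_tp assms)

lemma AE_tp:
  assumes "AE x in M. P x"
  shows "AE x in M. P (tp k x)"
proof (rule AE_distrD[OF tp_measurable])
  show "AE x in distr M M (tp k). P x" unfolding distr_tp by (rule assms)
qed

lemma subalgebra_obs: "subalgebra M (obs K)"
  by (rule subalgebra_obs_field[OF inv subalgebra_Y])

lemma space_obs [simp]: "space (obs K) = space M"
  using subalgebra_obs by (simp add: subalgebra_def)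

lemma tp_image: "A \<in> sets Y \<Longrightarrow> tp (- k) ` A = tp k -` A \<inter> space M"
  using tpow_image[OF inv, of A "- k"] subalgebra_Y by (auto simp: subalgebra_def)

lemma obs_generators: "{tp (- k) ` A | k A. k \<in> K \<and> A \<in> sets Y} \<subseteq> Pow (space M)"
proof clarify
  fix k A x assume "A \<in> sets Y" "x \<in> A"
  then show "tp (- k) x \<in> space M" using tp_image[of A k] by blast
qed

lemma sets_obs:
  "sets (obs K) = sigma_sets (space M) {tp (- k) ` A | k A. k \<in> K \<and> A \<in> sets Y}"
  unfolding obs_field_def by (rule sets_measure_of[OF obs_generators])

lemma obs_mono: "K \<subseteq> K' \<Longrightarrow> sets (obs K) \<subseteq> sets (obs K')"
  unfolding sets_obs by (rule sigma_sets_mono') auto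

lemma subalgebra_obs_mono: "K \<subseteq> K' \<Longrightarrow> subalgebra (obs K') (obs K)"
  using obs_mono by (simp add: subalgebra_def)

text \<open>Pulling back along \<open>tp j\<close> turns a generator of time \<open>k\<close> into
  one of time \<open>k + j\<close>. With negative \<open>j\<close> this moves observations into the
  past.\<close>

lemma tp_measurable_obs:
  assumes K: "\<And>k. k \<in> K \<Longrightarrow> k + j \<in> K'"
  shows "tp j \<in> measurable (obs K') (obs K)"
proof (rule measurable_sigma_sets[OF sets_obs obs_generators])
  fix B assume "B \<in> {tp (- k) ` A |k A. k \<in> K \<and> A \<in> sets Y}"
  then obtain k A where k: "k \<in> K" "A \<in> sets Y" and B: "B = tp (- k) ` A" by blast
  have "tp j -` B \<inter> space (obs K') = tp (- (k + j)) ` A"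
    unfolding B tp_image[OF k(2)] by (auto simp: tp_add[symmetric])
  also have "\<dots> \<in> sets (obs K')" unfolding sets_obs using K k by blast
  finally show "tp j -` B \<inter> space (obs K') \<in> sets (obs K')" .
qed auto

text \<open>Measurability in both directions means that \<open>G\<close> is the pullback of
  \<open>F\<close> under \<open>tp k\<close>. Each event of \<open>G\<close> thus corresponds to one
  of \<open>F\<close>, and invariance of the measure transports the integral identities that
  characterise conditional expectation.\<close>

lemma real_cond_exp_tp:
  assumes f: "integrable M f" and F: "subalgebra M F" and G: "subalgebra M G"
    and FG: "tp k \<in> measurable G F" "tp (- k) \<in> measurable F G"
  shows "AE x in M. real_cond_exp M G (\<lambda>x. f (tp k x)) x = real_cond_exp M F f (tp k x)"
proof -
  interpret F: sigma_finite_subalgebra M F by (rule sigma_finite_subalgebraI[OF F])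
  interpret G: sigma_finite_subalgebra M G by (rule sigma_finite_subalgebraI[OF G])
  have EF: "integrable M (real_cond_exp M F f)" by (rule F.real_cond_exp_int[OF f])
  show ?thesis
  proof (rule G.real_cond_exp_charact)
    show "integrable M (\<lambda>x. f (tp k x))" "integrable M (\<lambda>x. real_cond_exp M F f (tp k x))"
      by (intro integrable_tp f EF)+
    show "(\<lambda>x. real_cond_exp M F f (tp k x)) \<in> borel_measurable G"
      by (rule measurable_compose[OF FG(1)]) simp
    fix A assume A: "A \<in> sets G"
    define B where "B = tp (- k) -` A \<inter> space M"
    have spF: "space F = space M" using F by (simp add: subalgebra_def)
    have B: "B \<in> sets F" using measurable_sets[OF FG(2) A] by (simp add: B_def spF)
    have BM: "B \<in> sets M" using B F by (auto simp: subalgebra_def)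
    have set_int: "(\<integral>x\<in>A. h (tp k x) \<partial>M) = (\<integral>x\<in>B. h x \<partial>M)" if h: "integrable M h" for h :: "'a \<Rightarrow> real"
    proof -
      have "(\<integral>x\<in>A. h (tp k x) \<partial>M) = (\<integral>x. indicator B (tp k x) * h (tp k x) \<partial>M)"
        unfolding set_lebesgue_integral_def
        by (rule Bochner_Integration.integral_cong) (auto simp: B_def indicator_def)
      also have "\<dots> = (\<integral>x. indicator B x * h x \<partial>M)"
        by (rule integral_tp) (use h BM in measurable)
      finally show ?thesis by (simp add: set_lebesgue_integral_def)
    qed
    show "(\<integral>x\<in>A. f (tp k x) \<partial>M) = (\<integral>x\<in>A. real_cond_exp M F f (tp k x) \<partial>M)"
      unfolding set_int[OF f] set_int[OF EF] by (rule F.real_cond_exp_intA[OF f B])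
  qed
qed

section \<open>Weak mixing against integrable functions\<close>

text \<open>This is needed for h = 1_A - P[A|Z], which is no indicator. For fixed \<open>A\<close>
  the averages are seminorms in \<open>h\<close> bounded by twice its norm, uniformly in
  \<open>N\<close> by invariance of the measure, so density applies.\<close>

lemma cond_weak_mixing_L1:
  assumes wm: "cond_weak_mixing M T Z" and Z: "subalgebra M Z" and A: "A \<in> sets M"
    and h: "integrable M h"
  shows "(\<lambda>N. 1 / real N * (\<Sum>m=1..N. \<integral>x. \<bar>cond_cov M Z A (\<lambda>x. h (tp (- int m) x)) x\<bar> \<partial>M)) \<longlonglongrightarrow> 0"
proof (rule seminorms_vanish[where M = M and C = 2, OF _ _ _ _ _ h])
  let ?q = "\<lambda>m h. \<integral>x. \<bar>cond_cov M Z A (\<lambda>x. h (tp (- int m) x)) x\<bar> \<partial>M"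
  interpret sigma_finite_subalgebra M Z by (rule sigma_finite_subalgebraI[OF Z])
  show "0 \<le> 1 / real N * (\<Sum>m=1..N. ?q m f)" for N f
    by (intro mult_nonneg_nonneg sum_nonneg) auto
  note int = integrable_cond_cov[OF Z A]
  show "1 / real N * (\<Sum>m=1..N. ?q m (\<lambda>x. f x + g x))
      \<le> 1 / real N * (\<Sum>m=1..N. ?q m f) + 1 / real N * (\<Sum>m=1..N. ?q m g)"
    if f: "integrable M f" "integrable M g" for N f g
  proof -
    have "?q m (\<lambda>x. f x + g x) \<le> ?q m f + ?q m g" for m
      by (rule integral_abs_additive_le[where L = "cond_cov M Z A"])
        (auto intro!: int cond_cov_add[OF Z A] integrable_tp f)
    then show ?thesis
      unfolding distrib_left[symmetric] sum.distrib[symmetric]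
      by (intro mult_left_mono sum_mono) auto
  qed
  show "1 / real N * (\<Sum>m=1..N. ?q m (\<lambda>x. c * f x)) \<le> \<bar>c\<bar> * (1 / real N * (\<Sum>m=1..N. ?q m f))"
    if f: "integrable M f" for N c f
  proof -
    have "?q m (\<lambda>x. c * f x) = \<bar>c\<bar> * ?q m f" for m
      by (rule integral_abs_homogeneous[where L = "cond_cov M Z A"])
        (auto intro!: int cond_cov_cmult[OF Z A] integrable_tp f integrable_mult_right)
    then show ?thesis by (simp add: sum_distrib_left[symmetric] del: abs_mult)
  qed
  show "1 / real N * (\<Sum>m=1..N. ?q m f) \<le> 2 * (\<integral>x. \<bar>f x\<bar> \<partial>M)" if f: "integrable M f" for N f
  proof -
    have "?q m f \<le> 2 * (\<integral>x. \<bar>f x\<bar> \<partial>M)" for m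
      using cond_cov_bound[OF Z A integrable_tp[OF f, of "- int m"]]
        integral_tp[of "\<lambda>x. \<bar>f x\<bar>" "- int m"] f by simp
    then have "(\<Sum>m=1..N. ?q m f) \<le> real N * (2 * (\<integral>x. \<bar>f x\<bar> \<partial>M))"
      using sum_bounded_above[of "{1..N}" "\<lambda>m. ?q m f" "2 * (\<integral>x. \<bar>f x\<bar> \<partial>M)"] by simp
    then show ?thesis by (cases "N = 0") (auto simp: field_simps)
  qed
  show "(\<lambda>N. 1 / real N * (\<Sum>m=1..N. ?q m (indicator B))) \<longlonglongrightarrow> 0" if B: "B \<in> sets M" for B
  proof -
    let ?d = "\<lambda>k x. \<bar>cond_prob_on M Z (A \<inter> tp (int k) ` B) x
              - cond_prob_on M Z A x * cond_prob_on M Z (tp (int k) ` B) x\<bar>"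
    \<comment> \<open>On \<open>space M\<close> the indicator of the image of B under T^k is 1_B
      composed with T^(-k), which turns the covariance into the term of the mixing
      condition.\<close>
    have eq: "?q k (indicator B) = (\<integral>x. ?d k x \<partial>M)" and i: "integrable M (?d k)" for k
    proof -
      let ?C = "tp (int k) ` B"
      have C: "?C = tp (- int k) -` B \<inter> space M" by (rule tpow_image[OF inv B])
      have CM: "?C \<in> sets M" unfolding C using B by measurable
      have ae1: "AE x in M. real_cond_exp M Z (\<lambda>x. indicator A x * indicator B (tp (- int k) x)) x
          = cond_prob_on M Z (A \<inter> ?C) x"
        by (rule real_cond_exp_cong) (use A B CM in \<open>auto simp: C indicator_def\<close>)
      have ae2: "AE x in M. real_cond_exp M Z (\<lambda>x. indicator B (tp (- int k) x)) x = cond_prob_on M Z ?C x"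
        by (rule real_cond_exp_cong) (use A B CM in \<open>auto simp: C indicator_def\<close>)
      have ae: "AE x in M. \<bar>cond_cov M Z A (\<lambda>x. indicator B (tp (- int k) x)) x\<bar> = ?d k x"
        using ae1 ae2 by eventually_elim (simp add: cond_cov_def)
      have i': "integrable M (cond_cov M Z A (\<lambda>x. indicator B (tp (- int k) x)))"
        by (intro int integrable_tp integrable_indicator_prob B)
      show "?q k (indicator B) = (\<integral>x. ?d k x \<partial>M)"
        by (rule integral_cong_AE[OF _ _ ae]) (use i' in auto)
      show "integrable M (?d k)"
        using integrable_cong_AE[OF _ _ ae] i' by auto
    qed
    \<comment> \<open>All summands are nonnegative, so the L1 norm of the average is the average of
      the L1 norms.\<close>
    have avg: "(\<integral>x. \<bar>1 / real N * (\<Sum>k=1..N. ?d k x)\<bar> \<partial>M) = 1 / real N * (\<Sum>m=1..N. ?q m (indicator B))" for N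
    proof -
      have "(\<integral>x. \<bar>1 / real N * (\<Sum>k=1..N. ?d k x)\<bar> \<partial>M) = (\<integral>x. 1 / real N * (\<Sum>k=1..N. ?d k x) \<partial>M)"
        by (rule Bochner_Integration.integral_cong) (auto simp: sum_nonneg)
      also have "\<dots> = 1 / real N * (\<Sum>m=1..N. \<integral>x. ?d m x \<partial>M)"
        by (simp only: integral_mult_right_zero Bochner_Integration.integral_sum[OF i])
      finally show ?thesis by (simp only: eq)
    qed
    have "(\<lambda>N. \<integral>x. \<bar>1 / real N * (\<Sum>k=1..N. ?d k x)\<bar> \<partial>M) \<longlonglongrightarrow> 0"
      using wm A B unfolding cond_weak_mixing_def by blast
    then show ?thesis unfolding avg .
  qed
qed

end

section \<open>Second moments of averages with adapted weights\<close>

text \<open>A lag m is attained by at most two indices, k = j - m and k = j + m; hence the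
  2.\<close>

lemma sum_abs_diff_le:
  fixes c :: "nat \<Rightarrow> real"
  assumes c: "\<And>m. 0 \<le> c m" and j: "j \<in> {1..N}"
  shows "(\<Sum>k=1..N. c (nat \<bar>int j - int k\<bar>)) \<le> 2 * (\<Sum>m\<le>N. c m)"
proof -
  have "(\<Sum>k=1..N. c (nat \<bar>int j - int k\<bar>))
      = (\<Sum>k\<in>{1..j}. c (nat \<bar>int j - int k\<bar>)) + (\<Sum>k\<in>{j<..N}. c (nat \<bar>int j - int k\<bar>))"
    using j by (subst sum.union_disjoint[symmetric]) (auto intro!: sum.cong)
  also have "(\<Sum>k\<in>{1..j}. c (nat \<bar>int j - int k\<bar>)) \<le> (\<Sum>m\<le>N. c m)"
  proof (rule sum_le_included[where i = "\<lambda>m. j - m"])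
    show "\<forall>k\<in>{1..j}. \<exists>m\<in>{..N}. j - m = k \<and> c (nat \<bar>int j - int k\<bar>) \<le> c m"
    proof
      fix k assume "k \<in> {1..j}"
      then have eqs: "j - (j - k) = k" "j - k \<le> N" "nat \<bar>int j - int k\<bar> = j - k" using j by auto
      then show "\<exists>m\<in>{..N}. j - m = k \<and> c (nat \<bar>int j - int k\<bar>) \<le> c m" 
        by (intro bexI[of _ "j - k"] conjI) (simp_all only: eqs order_refl atMost_iff)
    qed
  qed (auto simp: c)
  also have "(\<Sum>k\<in>{j<..N}. c (nat \<bar>int j - int k\<bar>)) \<le> (\<Sum>m\<le>N. c m)"
  proof (rule sum_le_included[where i = "\<lambda>m. j + m"])
    show "\<forall>k\<in>{j<..N}. \<exists>m\<in>{..N}. j + m = k \<and> c (nat \<bar>int j - int k\<bar>) \<le> c m"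
    proof
      fix k assume "k \<in> {j<..N}"
      then have eqs: "j + (k - j) = k" "k - j \<le> N" "nat \<bar>int j - int k\<bar> = k - j" by auto
      then show "\<exists>m\<in>{..N}. j + m = k \<and> c (nat \<bar>int j - int k\<bar>) \<le> c m" 
        by (intro bexI[of _ "k - j"] conjI) (simp_all only: eqs order_refl atMost_iff)
    qed
  qed (auto simp: c)
  finally show ?thesis by simp
qed

lemma integrable_bounded_mult:
  fixes b h :: "'a \<Rightarrow> real"
  assumes b: "b \<in> borel_measurable M" "\<And>x. x \<in> space M \<Longrightarrow> \<bar>b x\<bar> \<le> 1" and h: "integrable M h"
  shows "integrable M (\<lambda>x. b x * h x)"
proof (rule Bochner_Integration.integrable_bound[OF h])
  show "AE x in M. norm (b x * h x) \<le> norm (h x)"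
    using mult_right_mono[OF b(2), of _ "\<bar>h _\<bar>"] by (auto simp: abs_mult)
qed (use b h in auto)

text \<open>E[b g] = E[b E[g|F]] for F-measurable \<open>b\<close>. The right-hand side no longer
  contains \<open>b\<close>, which is how the strategy drops out of the covariance
  estimates.\<close>

lemma (in prob_space) expectation_mult_bounded_le:
  assumes F: "subalgebra M F" and b: "b \<in> borel_measurable F" "\<And>x. x \<in> space M \<Longrightarrow> \<bar>b x\<bar> \<le> 1"
    and g: "integrable M g"
  shows "\<bar>\<integral>x. b x * g x \<partial>M\<bar> \<le> (\<integral>x. \<bar>real_cond_exp M F g x\<bar> \<partial>M)"
proof -
  interpret sigma_finite_subalgebra M F by (rule sigma_finite_subalgebraI[OF F])
  have bM: "b \<in> borel_measurable M" by (rule measurable_from_subalg[OF F b(1)])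
  have le: "\<bar>b x * h x\<bar> \<le> \<bar>h x\<bar>" if "x \<in> space M" for h :: "'a \<Rightarrow> real" and x
    using mult_right_mono[OF b(2)[OF that], of "\<bar>h x\<bar>"] by (simp add: abs_mult)
  have int: "integrable M (\<lambda>x. b x * h x)" if "integrable M h" for h :: "'a \<Rightarrow> real"
    by (rule integrable_bounded_mult[OF bM b(2) that])
  have E: "integrable M (real_cond_exp M F g)" by (rule real_cond_exp_int[OF g])
  have "(\<integral>x. b x * g x \<partial>M) = (\<integral>x. b x * real_cond_exp M F g x \<partial>M)"
    by (rule real_cond_exp_intg(2)[symmetric]) (use int[OF g] b g in auto)
  also have "\<bar>\<dots>\<bar> \<le> (\<integral>x. \<bar>b x * real_cond_exp M F g x\<bar> \<partial>M)" by (rule integral_abs_bound)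
  also have "\<dots> \<le> (\<integral>x. \<bar>real_cond_exp M F g x\<bar> \<partial>M)"
    by (rule integral_mono) (use int[OF E] E le in auto)
  finally show ?thesis .
qed

context observed_system
begin

text \<open>Truncation to [0,1] changes P[A|Z] on a null set only. Bounds at every point let the
  version be composed with iterates of T and keep the bound without further null sets.\<close>

lemma obtain_bounded_cond_prob:
  assumes "subalgebra M Z" "A \<in> sets M"
  obtains \<phi> where "\<phi> \<in> borel_measurable Z" "\<And>x. 0 \<le> \<phi> x" "\<And>x. \<phi> x \<le> 1"
    "AE x in M. cond_prob_on M Z A x = \<phi> x"
proof
  let ?f = "\<lambda>x. max 0 (min 1 (cond_prob_on M Z A x))"
  show "?f \<in> borel_measurable Z" by measurable
  show "AE x in M. cond_prob_on M Z A x = ?f x"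
    using cond_prob_on_bounds[OF assms] by eventually_elim simp
qed auto

text \<open>The second moment of the average is bounded by a quantity built from the lag covariances
  \<open>c m\<close>, in which the weights do not occur; their measurability enters through
  \<open>cross\<close>.\<close>

lemma adapted_average_centered:
  assumes wm: "cond_weak_mixing M T (obs {..0})" and A: "A \<in> sets M"
    and a: "\<And>k. k \<ge> 1 \<Longrightarrow> a k \<in> borel_measurable (obs {0..int k})"
      "\<And>k x. k \<ge> 1 \<Longrightarrow> x \<in> space M \<Longrightarrow> \<bar>a k x\<bar> \<le> 1"
    and \<phi>: "\<phi> \<in> borel_measurable (obs {..0})" "\<And>x. 0 \<le> \<phi> x" "\<And>x. \<phi> x \<le> 1"
      "AE x in M. cond_prob_on M (obs {..0}) A x = \<phi> x"
  shows "(\<lambda>N. \<integral>x. \<bar>1 / real N * (\<Sum>k=1..N. a k x * (indicator A (tp (int k) x) - \<phi> (tp (int k) x)))\<bar> \<partial>M) \<longlonglongrightarrow> 0"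
proof -
  let ?Z = "obs {..0}"
  have Z: "subalgebra M ?Z" by (rule subalgebra_obs)
  interpret sigma_finite_subalgebra M ?Z by (rule sigma_finite_subalgebraI[OF Z])
  have \<phi>M[measurable]: "\<phi> \<in> borel_measurable M" by (rule measurable_from_subalg[OF Z \<phi>(1)])
  have aM: "a k \<in> borel_measurable M" if "k \<ge> 1" for k
    by (rule measurable_from_subalg[OF subalgebra_obs a(1)[OF that]])
  define g :: "'a \<Rightarrow> real" where "g x = indicator A x - \<phi> x" for x
  have gM[measurable]: "g \<in> borel_measurable M" unfolding g_def using A by measurable
  have g1: "\<bar>g x\<bar> \<le> 1" for x using \<phi>(2,3)[of x] by (auto simp: g_def indicator_def)
  have ig: "integrable M g" by (rule integrable_const_bound[of _ 1]) (auto simp: g1)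
  define G where "G m x = g (tp (- int m) x)" for m x
  have iG: "integrable M (G m)" for m unfolding G_def[abs_def] by (rule integrable_tp[OF ig])
  have G1: "\<bar>G m x\<bar> \<le> 1" for m x by (simp add: G_def g1)
  have mult1: "\<bar>u * v\<bar> \<le> 1" if "\<bar>u\<bar> \<le> 1" "\<bar>v\<bar> \<le> 1" for u v :: real
    using mult_mono[OF that] by (simp add: abs_mult)
  have igG: "integrable M (\<lambda>x. g x * G m x)" for m
    by (rule integrable_const_bound[of _ 1]) (use iG in \<open>auto simp: mult1 g1 G1\<close>)
  \<comment> \<open>Shifting back by the later time \<open>k\<close> leaves \<open>g\<close> in
    place of the later factor and makes the earlier one \<open>G (k - j)\<close>, so a product at
    times j \<le> k is controlled by its lag.\<close>
  define c where "c m = (\<integral>x. \<bar>real_cond_exp M ?Z (\<lambda>x. g x * G m x) x\<bar> \<partial>M)" for m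
  have c0: "0 \<le> c m" for m by (simp add: c_def)
  \<comment> \<open>\<open>\<phi>\<close> is measurable for the conditioning field and factors out;
    centring the first factor at \<open>\<phi>\<close> therefore turns the conditional mean of the
    product into the conditional covariance with \<open>A\<close>.\<close>
  have c_cov: "c m = (\<integral>x. \<bar>cond_cov M ?Z A (\<lambda>x. g (tp (- int m) x)) x\<bar> \<partial>M)" for m
  proof -
    have i1: "integrable M (\<lambda>x. indicator A x * G m x)" by (rule integrable_indicator_mult[OF A iG])
    have i2: "integrable M (\<lambda>x. \<phi> x * G m x)"
      by (rule integrable_const_bound[of _ 1]) (use iG \<phi> in \<open>auto simp: mult1 G1\<close>)
    have "AE x in M. real_cond_exp M ?Z (\<lambda>x. indicator A x * G m x - \<phi> x * G m x) x
        = real_cond_exp M ?Z (\<lambda>x. indicator A x * G m x) x - real_cond_exp M ?Z (\<lambda>x. \<phi> x * G m x) x"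
      by (rule real_cond_exp_diff[OF i1 i2])
    moreover have "AE x in M. real_cond_exp M ?Z (\<lambda>x. \<phi> x * G m x) x = \<phi> x * real_cond_exp M ?Z (G m) x"
      by (rule real_cond_exp_mult[OF \<phi>(1) _ i2]) (use iG in auto)
    moreover have eq: "(\<lambda>x. g x * G m x) = (\<lambda>x. indicator A x * G m x - \<phi> x * G m x)"
      by (simp add: g_def algebra_simps)
    note \<phi>(4)
    ultimately have ae: "AE x in M. real_cond_exp M ?Z (\<lambda>x. g x * G m x) x = cond_cov M ?Z A (G m) x"
      by eventually_elim (simp add: cond_cov_def eq)
    have "c m = (\<integral>x. \<bar>cond_cov M ?Z A (G m) x\<bar> \<partial>M)"
      unfolding c_def
    proof (rule integral_cong_AE)
      show "(\<lambda>x. \<bar>cond_cov M ?Z A (G m) x\<bar>) \<in> borel_measurable M"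
        using integrable_cond_cov[OF Z A iG, of m] by auto
    qed (use ae in auto)
    then show ?thesis by (simp add: G_def[abs_def])
  qed
  have c_avg: "(\<lambda>N. 1 / real N * (\<Sum>m=1..N. c m)) \<longlonglongrightarrow> 0"
    unfolding c_cov by (rule cond_weak_mixing_L1[OF wm Z A ig])

  define X where "X k x = a k x * g (tp (int k) x)" for k x
  have XM: "X k \<in> borel_measurable M" if "k \<ge> 1" for k
    unfolding X_def[abs_def] using aM[OF that] by measurable
  have X1: "\<bar>X k x\<bar> \<le> 1" if "k \<ge> 1" "x \<in> space M" for k x
    unfolding X_def by (rule mult1[OF a(2)[OF that] g1])
  have iXX: "integrable M (\<lambda>x. X j x * X k x)" if "j \<ge> 1" "k \<ge> 1" for j k
    by (rule integrable_const_bound[of _ 1]) (use XM that X1 in \<open>auto intro!: AE_I2 mult1\<close>)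
  have iX: "integrable M (X k)" if "k \<ge> 1" for k
    by (rule integrable_const_bound[of _ 1]) (use XM that X1 in \<open>auto intro!: AE_I2\<close>)
  have cross: "(\<integral>x. X j x * X k x \<partial>M) \<le> c (k - j)" if jk: "1 \<le> j" "j \<le> k" for j k
  proof -
    define b where "b x = a j (tp (- int k) x) * a k (tp (- int k) x)" for x
    \<comment> \<open>Observation times 0..i become -k..i-k, which stay in the past because i \<le>
      k; shifting by the earlier time would leave the later weight dependent on future
      observations.\<close>
    have "tp (- int k) \<in> measurable ?Z (obs {0..int i})" if "i \<le> k" for i
      by (rule tp_measurable_obs) (use that in auto)
    note bm = measurable_compose[OF this a(1)]
    have bZ: "b \<in> borel_measurable ?Z"
      unfolding b_def[abs_def] by (intro borel_measurable_times bm) (use jk in auto)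
    have b1: "\<bar>b x\<bar> \<le> 1" if "x \<in> space M" for x
      unfolding b_def by (rule mult1) (use that jk in \<open>auto intro!: a(2)\<close>)
    have "(\<integral>x. X j x * X k x \<partial>M) = (\<integral>x. X j (tp (- int k) x) * X k (tp (- int k) x) \<partial>M)"
      by (rule integral_tp[symmetric]) (use iXX[of j k] jk in auto)
    also have "\<dots> = (\<integral>x. b x * (g x * G (k - j) x) \<partial>M)"
    proof (rule Bochner_Integration.integral_cong[OF refl])
      fix x assume x: "x \<in> space M"
      have "tp (int j) (tp (- int k) x) = tp (- int (k - j)) x"
        using tp_add[OF x, of "int j" "- int k"] jk by (simp add: of_nat_diff)
      then show "X j (tp (- int k) x) * X k (tp (- int k) x) = b x * (g x * G (k - j) x)"
        using x by (simp add: X_def b_def G_def)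
    qed
    also have "\<dots> \<le> c (k - j)"
      unfolding c_def using expectation_mult_bounded_le[OF Z bZ b1 igG[of "k - j"]] by simp
    finally show ?thesis .
  qed
  have cross': "(\<integral>x. X j x * X k x \<partial>M) \<le> c (nat \<bar>int j - int k\<bar>)" if jk: "1 \<le> j" "1 \<le> k" for j k
  proof (cases "j \<le> k")
    case True
    then have eq: "nat \<bar>int j - int k\<bar> = k - j" by simp
    show ?thesis unfolding eq by (rule cross[OF jk(1) True])
  next
    case False
    then have eq: "nat \<bar>int j - int k\<bar> = j - k" by simp
    show ?thesis unfolding eq using cross[OF jk(2), of j] False by (simp add: mult.commute)
  qed
  define S where "S N x = 1 / real N * (\<Sum>k=1..N. X k x)" for N x
  have iS: "integrable M (S N)" for N unfolding S_def[abs_def] 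
    by (intro integrable_mult_right Bochner_Integration.integrable_sum iX) auto
  have S2: "(S N x)\<^sup>2 = (1 / real N)\<^sup>2 * (\<Sum>j=1..N. \<Sum>k=1..N. X j x * X k x)" for N x
    unfolding S_def power_mult_distrib power2_eq_square[of "sum _ _"] sum_product ..
  have iS2: "integrable M (\<lambda>x. (S N x)\<^sup>2)" for N 
    unfolding S2 by (intro integrable_mult_right Bochner_Integration.integrable_sum iXX) auto
  have bound: "(\<integral>x. (S N x)\<^sup>2 \<partial>M) \<le> 2 * (c 0 * (1 / real N) + 1 / real N * (\<Sum>m=1..N. c m))" for N
  proof -
    have "(\<integral>x. (S N x)\<^sup>2 \<partial>M) = (1 / real N)\<^sup>2 * (\<Sum>j=1..N. \<Sum>k=1..N. \<integral>x. X j x * X k x \<partial>M)"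
    proof -
      have "(\<integral>x. (\<Sum>j=1..N. \<Sum>k=1..N. X j x * X k x) \<partial>M) = (\<Sum>j=1..N. \<integral>x. (\<Sum>k=1..N. X j x * X k x) \<partial>M)"
        by (intro Bochner_Integration.integral_sum Bochner_Integration.integrable_sum iXX) auto
      also have "\<dots> = (\<Sum>j=1..N. \<Sum>k=1..N. \<integral>x. X j x * X k x \<partial>M)"
        by (intro sum.cong refl Bochner_Integration.integral_sum iXX) auto
      finally show ?thesis unfolding S2 by simp
    qed
    also have "\<dots> \<le> (1 / real N)\<^sup>2 * (\<Sum>j=1..N. 2 * (\<Sum>m\<le>N. c m))"
    proof (intro mult_left_mono sum_mono)
      fix j assume j: "j \<in> {1..N}"
      have "(\<Sum>k=1..N. \<integral>x. X j x * X k x \<partial>M) \<le> (\<Sum>k=1..N. c (nat \<bar>int j - int k\<bar>))"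
        by (rule sum_mono) (use j in \<open>auto intro!: cross'\<close>)
      also have "\<dots> \<le> 2 * (\<Sum>m\<le>N. c m)" by (rule sum_abs_diff_le[OF c0 j])
      finally show "(\<Sum>k=1..N. \<integral>x. X j x * X k x \<partial>M) \<le> 2 * (\<Sum>m\<le>N. c m)" .
    qed simp
    also have "\<dots> = 2 * (1 / real N * (\<Sum>m\<le>N. c m))"
      by (simp add: power2_eq_square)
    \<comment> \<open>The mixing averages start at lag 1. The diagonal lag 0 is split off, and it
      contributes a multiple of 1/N.\<close>
    also have "(\<Sum>m\<le>N. c m) = c 0 + (\<Sum>m=1..N. c m)"
      using sum.atLeast_Suc_atMost[of 0 N c] by (simp add: atLeast0AtMost)
    finally show ?thesis by (simp add: distrib_left mult.commute)
  qed
  have "(\<lambda>N. 2 * (c 0 * (1 / real N) + 1 / real N * (\<Sum>m=1..N. c m))) \<longlonglongrightarrow> 2 * (c 0 * 0 + 0)"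
    by (intro tendsto_mult_left tendsto_add c_avg lim_1_over_n)
  then have "(\<lambda>N. \<integral>x. (S N x)\<^sup>2 \<partial>M) \<longlonglongrightarrow> 0"
    by (intro tendsto_zero_squeeze[OF _ bound]) simp_all
  then have "(\<lambda>N. sqrt (\<integral>x. (S N x)\<^sup>2 \<partial>M)) \<longlonglongrightarrow> 0"
    using tendsto_real_sqrt by fastforce
  then have "(\<lambda>N. \<integral>x. \<bar>S N x\<bar> \<partial>M) \<longlonglongrightarrow> 0"
    by (rule tendsto_zero_squeeze[rotated 2]) (auto intro: expectation_abs_le_sqrt iS iS2)
  then show ?thesis by (simp only: S_def X_def g_def)
qed

section \<open>From the infinite past to the observations since time 0\<close>

text \<open>Shifting by -k replaces the function moving with k by a fixed one and the field Y_{0,k}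
  by Y_{-k,0}, which increases to Z. The tower property then exchanges \<open>f\<close> for its
  projection \<open>\<phi>\<close>, to which Levy's theorem applies because it is
  Z-measurable.\<close>

lemma real_cond_exp_obs_tendsto:
  fixes f :: "'a \<Rightarrow> real"
  assumes f: "integrable M f" and \<phi>: "\<phi> \<in> borel_measurable (obs {..0})"
    and ae: "AE x in M. real_cond_exp M (obs {..0}) f x = \<phi> x"
  shows "(\<lambda>k. \<integral>x. \<bar>\<phi> (tp (int k) x) - real_cond_exp M (obs {0..int k}) (\<lambda>x. f (tp (int k) x)) x\<bar> \<partial>M) \<longlonglongrightarrow> 0"
proof -
  let ?Z = "obs {..0}" and ?F = "\<lambda>k. obs {- int k..0}"
  interpret Z: sigma_finite_subalgebra M ?Z by (rule sigma_finite_subalgebraI[OF subalgebra_obs])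
  have \<phi>M [measurable]: "\<phi> \<in> borel_measurable M" by (rule measurable_from_subalg[OF subalgebra_obs \<phi>])
  have i\<phi>: "integrable M \<phi>"
    using integrable_cong_AE[OF _ _ ae] Z.real_cond_exp_int(1)[OF f] by auto
  have generate: "sets ?Z = sigma_sets (space M) (\<Union>k. sets (?F k))"
  proof
    show "sets ?Z \<subseteq> sigma_sets (space M) (\<Union>k. sets (?F k))"
      unfolding sets_obs[of "{..0}"]
    proof (rule sigma_sets_mono, rule subsetI)
      fix B assume "B \<in> {tp (- k) ` A |k A. k \<in> {..0} \<and> A \<in> sets Y}"
      then obtain i A where "i \<in> {..0::int}" "A \<in> sets Y" and B: "B = tp (- i) ` A" by blast
      \<comment> \<open>A generator of time i \<le> 0 already belongs to the field with index
        -i.\<close>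
      then have "tp (- i) ` A \<in> sets (?F (nat (- i)))"
        unfolding sets_obs by (intro sigma_sets.Basic CollectI exI[of _ i] exI[of _ A]) auto
      then show "B \<in> sigma_sets (space M) (\<Union>k. sets (?F k))" unfolding B
        by (rule sigma_sets.Basic[OF UN_I[OF UNIV_I]])
    qed
    have "(\<Union>k. sets (?F k)) \<subseteq> sets ?Z" using obs_mono[of "{- int _..0}" "{..0}"] by fastforce
    from sets.sigma_sets_subset[OF this]
    show "sigma_sets (space M) (\<Union>k. sets (?F k)) \<subseteq> sets ?Z" by simp
  qed
  have "(\<lambda>k. \<integral>x. \<bar>\<phi> x - real_cond_exp M (?F k) \<phi> x\<bar> \<partial>M) \<longlonglongrightarrow> 0"
    by (rule levy_upward_L1[OF subalgebra_obs obs_mono subalgebra_obs generate i\<phi> \<phi>]) auto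
  moreover have "(\<integral>x. \<bar>\<phi> (tp (int k) x) - real_cond_exp M (obs {0..int k}) (\<lambda>x. f (tp (int k) x)) x\<bar> \<partial>M)
      = (\<integral>x. \<bar>\<phi> x - real_cond_exp M (?F k) \<phi> x\<bar> \<partial>M)" for k
  proof -
    interpret F: sigma_finite_subalgebra M "?F k" by (rule sigma_finite_subalgebraI[OF subalgebra_obs])
    have "AE x in M. real_cond_exp M (?F k) (real_cond_exp M ?Z f) x = real_cond_exp M (?F k) f x"
      by (rule F.real_cond_exp_nested_subalg[OF subalgebra_obs subalgebra_obs_mono f]) auto
    moreover have "AE x in M. real_cond_exp M (?F k) (real_cond_exp M ?Z f) x = real_cond_exp M (?F k) \<phi> x"
      by (rule F.real_cond_exp_cong[OF ae]) auto
    ultimately have "AE x in M. real_cond_exp M (?F k) f x = real_cond_exp M (?F k) \<phi> x"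
      by eventually_elim simp
    then have "AE x in M. real_cond_exp M (?F k) f (tp (int k) x) = real_cond_exp M (?F k) \<phi> (tp (int k) x)"
      by (rule AE_tp)
    moreover have "AE x in M. real_cond_exp M (obs {0..int k}) (\<lambda>x. f (tp (int k) x)) x
        = real_cond_exp M (?F k) f (tp (int k) x)"
      by (rule real_cond_exp_tp[OF f subalgebra_obs subalgebra_obs]) (auto intro!: tp_measurable_obs)
    ultimately have "AE x in M. \<bar>\<phi> (tp (int k) x) - real_cond_exp M (obs {0..int k}) (\<lambda>x. f (tp (int k) x)) x\<bar>
        = \<bar>\<phi> (tp (int k) x) - real_cond_exp M (?F k) \<phi> (tp (int k) x)\<bar>"
      by eventually_elim simp
    then have "(\<integral>x. \<bar>\<phi> (tp (int k) x) - real_cond_exp M (obs {0..int k}) (\<lambda>x. f (tp (int k) x)) x\<bar> \<partial>M)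
       = (\<integral>x. \<bar>\<phi> (tp (int k) x) - real_cond_exp M (?F k) \<phi> (tp (int k) x)\<bar> \<partial>M)"
      by (intro integral_cong_AE) auto
    also have "\<dots> = (\<integral>x. \<bar>\<phi> x - real_cond_exp M (?F k) \<phi> x\<bar> \<partial>M)"
      by (rule integral_tp[of "\<lambda>x. \<bar>\<phi> x - real_cond_exp M (?F k) \<phi> x\<bar>"]) auto
    finally show ?thesis .
  qed
  ultimately show ?thesis by simp
qed

text \<open>For fixed weights the averages are linear in \<open>f\<close> with norm at most 2, one
  for the identity and one for the conditional expectation, so indicators suffice. There the
  centring is split at \<open>\<phi>\<close> composed with T^k: the first part is the second moment
  estimate, and the second, whatever the bounded weights, is a Cesaro mean of Levy errors.\<close>

lemma adapted_average_L1:
  fixes f :: "'a \<Rightarrow> real"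
  assumes wm: "cond_weak_mixing M T (obs {..0})"
    and a: "\<And>k. k \<ge> 1 \<Longrightarrow> a k \<in> borel_measurable (obs {0..int k})"
      "\<And>k x. k \<ge> 1 \<Longrightarrow> x \<in> space M \<Longrightarrow> \<bar>a k x\<bar> \<le> 1"
    and f: "integrable M f"
  shows "(\<lambda>N. \<integral>x. \<bar>1 / real N * (\<Sum>k=1..N. a k x * (f (tp (int k) x)
      - real_cond_exp M (obs {0..int k}) (\<lambda>x. f (tp (int k) x)) x))\<bar> \<partial>M) \<longlonglongrightarrow> 0"
proof -
  define D where "D f k x = f (tp (int k) x) - real_cond_exp M (obs {0..int k}) (\<lambda>x. f (tp (int k) x)) x"
    for f :: "'a \<Rightarrow> real" and k x
  define L where "L N f x = 1 / real N * (\<Sum>k=1..N. a k x * D f k x)" for N f x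
  have sf: "sigma_finite_subalgebra M (obs K)" for K by (rule sigma_finite_subalgebraI[OF subalgebra_obs])
  have aM: "a k \<in> borel_measurable M" if "k \<ge> 1" for k
    by (rule measurable_from_subalg[OF subalgebra_obs a(1)[OF that]])
  have le: "\<bar>a k x * u\<bar> \<le> \<bar>u\<bar>" if "k \<ge> 1" "x \<in> space M" for k x u
    using mult_right_mono[OF a(2)[OF that], of "\<bar>u\<bar>"] by (simp add: abs_mult)
  have aint: "integrable M (\<lambda>x. a k x * h x)" if "k \<ge> 1" "integrable M h" for h k
    by (rule integrable_bounded_mult[OF aM a(2)]) (use that in auto)
  have iE: "integrable M (real_cond_exp M (obs {0..int k}) (\<lambda>x. f (tp (int k) x)))" if "integrable M f" for f k
    by (rule sigma_finite_subalgebra.real_cond_exp_int[OF sf integrable_tp[OF that]])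
  have iD: "integrable M (D f k)" if "integrable M f" for f k
    unfolding D_def[abs_def] using iE[OF that] integrable_tp[OF that] by auto
  have iL: "integrable M (L N f)" if "integrable M f" for N f
    unfolding L_def[abs_def] by (intro integrable_mult_right Bochner_Integration.integrable_sum aint iD that) auto
  have Dadd: "AE x in M. \<forall>k. D (\<lambda>x. f x + g x) k x = D f k x + D g k x"
    if "integrable M f" "integrable M g" for f g
  proof (subst AE_all_countable, rule)
    fix k
    show "AE x in M. D (\<lambda>x. f x + g x) k x = D f k x + D g k x"
      using sigma_finite_subalgebra.real_cond_exp_add[OF sf integrable_tp[OF that(1)] integrable_tp[OF that(2)],
          of "{0..int k}" "int k" "int k"]
      by eventually_elim (simp add: D_def)
  qed
  have Dcmult: "AE x in M. \<forall>k. D (\<lambda>x. c * f x) k x = c * D f k x" if "integrable M f" for f c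
  proof (subst AE_all_countable, rule)
    fix k
    show "AE x in M. D (\<lambda>x. c * f x) k x = c * D f k x"
      using sigma_finite_subalgebra.real_cond_exp_cmult[OF sf integrable_tp[OF that], of "{0..int k}" c "int k"]
      by eventually_elim (simp add: D_def algebra_simps)
  qed
  have L_le: "(\<integral>x. \<bar>L N f x\<bar> \<partial>M) \<le> 1 / real N * (\<Sum>k=1..N. \<integral>x. \<bar>D f k x\<bar> \<partial>M)"
    if f: "integrable M f" for N f
  proof -
    have "(\<integral>x. \<bar>L N f x\<bar> \<partial>M) \<le> (\<integral>x. 1 / real N * (\<Sum>k=1..N. \<bar>D f k x\<bar>) \<partial>M)"
    proof (rule integral_mono)
      fix x assume x: "x \<in> space M"
      have "\<bar>\<Sum>k=1..N. a k x * D f k x\<bar> \<le> (\<Sum>k=1..N. \<bar>D f k x\<bar>)"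
        by (rule order_trans[OF sum_abs sum_mono]) (use x in \<open>auto intro: le\<close>)
      then show "\<bar>L N f x\<bar> \<le> 1 / real N * (\<Sum>k=1..N. \<bar>D f k x\<bar>)"
        unfolding L_def abs_mult by (intro mult_mono) auto
    qed (use iL[OF f] iD[OF f] in auto)
    also have "\<dots> = 1 / real N * (\<Sum>k=1..N. \<integral>x. \<bar>D f k x\<bar> \<partial>M)"
      using iD[OF f] by simp
    finally show ?thesis .
  qed
  have "(\<lambda>N. \<integral>x. \<bar>L N f x\<bar> \<partial>M) \<longlonglongrightarrow> 0"
  proof (rule seminorms_vanish[where M = M and C = 2, OF _ _ _ _ _ f])
    show "(\<integral>x. \<bar>L N (\<lambda>x. f x + g x) x\<bar> \<partial>M) \<le> (\<integral>x. \<bar>L N f x\<bar> \<partial>M) + (\<integral>x. \<bar>L N g x\<bar> \<partial>M)"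
      if fg: "integrable M f" "integrable M g" for N f g
    proof (rule integral_abs_additive_le)
      show "AE x in M. L N (\<lambda>x. f x + g x) x = L N f x + L N g x"
        using Dadd[OF fg] by eventually_elim (simp add: L_def distrib_left sum.distrib add_divide_distrib)
    qed (use fg in \<open>auto intro!: iL\<close>)
    show "(\<integral>x. \<bar>L N (\<lambda>x. c * f x) x\<bar> \<partial>M) \<le> \<bar>c\<bar> * (\<integral>x. \<bar>L N f x\<bar> \<partial>M)" if f: "integrable M f" for N c f
    proof (rule eq_refl, rule integral_abs_homogeneous)
      show "AE x in M. L N (\<lambda>x. c * f x) x = c * L N f x"
        using Dcmult[OF f, of c] by eventually_elim (simp add: L_def sum_distrib_left algebra_simps)
    qed (use f in \<open>auto intro!: iL\<close>)
    show "(\<integral>x. \<bar>L N f x\<bar> \<partial>M) \<le> 2 * (\<integral>x. \<bar>f x\<bar> \<partial>M)" if f: "integrable M f" for N f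
    proof -
      have "(\<integral>x. \<bar>D f k x\<bar> \<partial>M) \<le> 2 * (\<integral>x. \<bar>f x\<bar> \<partial>M)" for k
      proof -
        let ?f = "\<lambda>x. f (tp (int k) x)"
        have "(\<integral>x. \<bar>D f k x\<bar> \<partial>M) \<le> (\<integral>x. \<bar>?f x\<bar> + \<bar>real_cond_exp M (obs {0..int k}) ?f x\<bar> \<partial>M)"
          by (rule integral_mono) (use iD[OF f] iE[OF f] integrable_tp[OF f] in \<open>auto simp: D_def\<close>)
        also have "\<dots> = (\<integral>x. \<bar>?f x\<bar> \<partial>M) + (\<integral>x. \<bar>real_cond_exp M (obs {0..int k}) ?f x\<bar> \<partial>M)"
          by (rule Bochner_Integration.integral_add) (use iE[OF f] integrable_tp[OF f] in auto)
        also have "\<dots> \<le> (\<integral>x. \<bar>?f x\<bar> \<partial>M) + (\<integral>x. \<bar>?f x\<bar> \<partial>M)"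
          by (intro add_left_mono sigma_finite_subalgebra.real_cond_exp_contraction[OF sf] integrable_tp f)
        finally show ?thesis using integral_tp[of "\<lambda>x. \<bar>f x\<bar>" "int k"] f by simp
      qed
      then have "(\<Sum>k=1..N. \<integral>x. \<bar>D f k x\<bar> \<partial>M) \<le> real N * (2 * (\<integral>x. \<bar>f x\<bar> \<partial>M))"
        using sum_bounded_above[of "{1..N}" "\<lambda>k. \<integral>x. \<bar>D f k x\<bar> \<partial>M" "2 * (\<integral>x. \<bar>f x\<bar> \<partial>M)"] by simp
      then have "1 / real N * (\<Sum>k=1..N. \<integral>x. \<bar>D f k x\<bar> \<partial>M) \<le> 2 * (\<integral>x. \<bar>f x\<bar> \<partial>M)"
        by (cases "N = 0") (auto simp: field_simps)
      with L_le[OF f, of N] show ?thesis by linarith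
    qed
    fix A assume A: "A \<in> sets M"
    obtain \<phi> where \<phi>: "\<phi> \<in> borel_measurable (obs {..0})" "\<And>x. 0 \<le> \<phi> x" "\<And>x. \<phi> x \<le> 1"
      "AE x in M. cond_prob_on M (obs {..0}) A x = \<phi> x"
      by (rule obtain_bounded_cond_prob[OF subalgebra_obs[of "{..0}"] A]) (rule that)
    have \<phi>M [measurable]: "\<phi> \<in> borel_measurable M" by (rule measurable_from_subalg[OF subalgebra_obs \<phi>(1)])
    have i\<phi>: "integrable M \<phi>" by (rule integrable_const_bound[of _ 1]) (auto simp: \<phi>)
    note iA = integrable_indicator_prob[OF A]
    define S where "S N x = 1 / real N * (\<Sum>k=1..N. a k x * (indicator A (tp (int k) x) - \<phi> (tp (int k) x)))" for N x
    define R where "R k x = \<bar>\<phi> (tp (int k) x) - real_cond_exp M (obs {0..int k}) (\<lambda>x. indicator A (tp (int k) x)) x\<bar>" for k x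
    have iS: "integrable M (S N)" for N
      unfolding S_def[abs_def]

      by (intro integrable_mult_right Bochner_Integration.integrable_sum aint
          Bochner_Integration.integrable_diff integrable_tp[OF iA] integrable_tp[OF i\<phi>]) auto
    have iR: "integrable M (R k)" for k
      unfolding R_def[abs_def] using iE[OF iA] integrable_tp[OF i\<phi>] by auto
    have "(\<integral>x. \<bar>L N (indicator A) x\<bar> \<partial>M) \<le> (\<integral>x. \<bar>S N x\<bar> \<partial>M) + 1 / real N * (\<Sum>k=1..N. \<integral>x. R k x \<partial>M)" for N
    proof -
      have "(\<integral>x. \<bar>L N (indicator A) x\<bar> \<partial>M) \<le> (\<integral>x. \<bar>S N x\<bar> + 1 / real N * (\<Sum>k=1..N. R k x) \<partial>M)"
      proof (rule integral_mono)
        fix x assume x: "x \<in> space M"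
        let ?r = "\<lambda>k. \<phi> (tp (int k) x) - real_cond_exp M (obs {0..int k}) (\<lambda>x. indicator A (tp (int k) x)) x"
        have "L N (indicator A) x = S N x + 1 / real N * (\<Sum>k=1..N. a k x * ?r k)"
          unfolding L_def S_def D_def distrib_left[symmetric] sum.distrib[symmetric] by simp
        moreover have "\<bar>\<Sum>k=1..N. a k x * ?r k\<bar> \<le> (\<Sum>k=1..N. R k x)"
          unfolding R_def by (rule order_trans[OF sum_abs sum_mono]) (use x in \<open>auto intro: le\<close>)
        then have "\<bar>1 / real N * (\<Sum>k=1..N. a k x * ?r k)\<bar> \<le> 1 / real N * (\<Sum>k=1..N. R k x)"
          unfolding abs_mult by (intro mult_mono) auto
        ultimately show "\<bar>L N (indicator A) x\<bar> \<le> \<bar>S N x\<bar> + 1 / real N * (\<Sum>k=1..N. R k x)" by linarith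
      qed (use iL[OF iA] iS iR in auto)
      also have "\<dots> = (\<integral>x. \<bar>S N x\<bar> \<partial>M) + 1 / real N * (\<Sum>k=1..N. \<integral>x. R k x \<partial>M)"
        using iS iR by simp
      finally show ?thesis .
    qed
    moreover have "(\<lambda>N. \<integral>x. \<bar>S N x\<bar> \<partial>M) \<longlonglongrightarrow> 0"
      unfolding S_def by (rule adapted_average_centered[OF wm A a \<phi>])
    moreover have "(\<lambda>N. 1 / real N * (\<Sum>k=1..N. \<integral>x. R k x \<partial>M)) \<longlonglongrightarrow> 0"
      unfolding R_def by (intro cesaro_mean_tendsto_zero real_cond_exp_obs_tendsto[OF iA \<phi>(1,4)])
    ultimately show "(\<lambda>N. \<integral>x. \<bar>L N (indicator A) x\<bar> \<partial>M) \<longlonglongrightarrow> 0"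
      by (rule tendsto_zero_squeeze[rotated, OF _ tendsto_add_zero]) simp_all
  qed simp
  then show ?thesis by (simp only: L_def D_def)
qed

end

section \<open>Finite decision spaces, conditional losses and pathwise optimality\<close>

text \<open>Singletons of the finite decision space need not be measurable; the weights are indicators
  of the atoms of its \<open>\<sigma>\<close>-algebra, each attached to a chosen representative of the atom.\<close>

lemma finite_space_measurable_weights:
  fixes U :: "'u measure"
  assumes fin: "finite (space U)"
  obtains w :: "'u \<Rightarrow> 'u \<Rightarrow> real" where "\<And>v. w v \<in> borel_measurable U" "\<And>v u. \<bar>w v u\<bar> \<le> 1"
    "\<And>(h :: 'u \<Rightarrow> real) u. h \<in> borel_measurable U \<Longrightarrow> u \<in> space U \<Longrightarrow> h u = (\<Sum>v\<in>space U. w v u * h v)"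
proof
  define A where "A u = \<Inter>{C \<in> sets U. u \<in> C}" for u
  \<comment> \<open>The choice is made from the set \<open>A u\<close>, so all points with the same
    atom receive the same representative.\<close>
  define rep where "rep u = (SOME v. v \<in> A u)" for u
  define w :: "'u \<Rightarrow> 'u \<Rightarrow> real" where "w v u = indicator {u \<in> space U. rep u = v} u" for v u
  have self: "u \<in> A u" for u by (simp add: A_def)
  have rep: "rep u \<in> A u" for u unfolding rep_def by (rule someI[where P = "\<lambda>v. v \<in> A u"]) (rule self)
  have As: "A u \<in> sets U" if "u \<in> space U" for u
  proof -
    have "finite (sets U)" by (rule finite_subset[OF sets.space_closed]) (simp add: fin)
    then have "finite {C \<in> sets U. u \<in> C}" by simp
    moreover have "{C \<in> sets U. u \<in> C} \<noteq> {}" using that sets.top by blast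
    ultimately have "(\<Inter>C\<in>{C \<in> sets U. u \<in> C}. C) \<in> sets U" by (rule sets.finite_INT) simp
    then show ?thesis by (simp add: A_def)
  qed
  have least: "A u \<subseteq> C" if "C \<in> sets U" "u \<in> C" for u C using that by (auto simp: A_def)
  have A_eq: "A v = A u" if u: "u \<in> space U" and v: "v \<in> A u" for u v
  proof
    have vU: "v \<in> space U" using sets.sets_into_space[OF As[OF u]] v by auto
    show "A v \<subseteq> A u" by (rule least[OF As[OF u] v])
    have "u \<in> A v"
    proof (rule ccontr)
      \<comment> \<open>Otherwise \<open>A u - A v\<close> would be a smaller measurable set around
        \<open>u\<close>, although \<open>A u\<close> contains \<open>v\<close>.\<close>
      assume "u \<notin> A v"
      then have "A u \<subseteq> A u - A v" using self by (intro least sets.Diff As u vU) auto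
      then show False using v self[of v] by auto
    qed
    then show "A u \<subseteq> A v" by (rule least[OF As[OF vU]])
  qed
  show "w v \<in> borel_measurable U" for v
  proof -
    have "{u \<in> space U. rep u = v} = \<Union>(A ` {u \<in> space U. rep u = v})"
    proof (rule set_eqI, rule iffI)
      fix x assume "x \<in> {u \<in> space U. rep u = v}"
      then show "x \<in> \<Union>(A ` {u \<in> space U. rep u = v})" using self by blast
    next
      fix x assume "x \<in> \<Union>(A ` {u \<in> space U. rep u = v})"
      then obtain u where u: "u \<in> space U" "rep u = v" "x \<in> A u" by auto
      then show "x \<in> {u \<in> space U. rep u = v}"
        using A_eq[OF u(1,3)] sets.sets_into_space[OF As[OF u(1)]] by (auto simp: rep_def)
    qed
    moreover have "\<Union>(A ` {u \<in> space U. rep u = v}) \<in> sets U"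
      using As fin by (intro sets.finite_Union) auto
    ultimately have "{u \<in> space U. rep u = v} \<in> sets U" by simp
    then show ?thesis unfolding w_def[abs_def]
      by (subst measurable_cong[where g = "indicator {u \<in> space U. rep u = v}"]) auto
  qed
  show "\<bar>w v u\<bar> \<le> 1" for v u by (simp add: w_def indicator_def)
  show "h u = (\<Sum>v\<in>space U. w v u * h v)" if h: "h \<in> borel_measurable U" and u: "u \<in> space U"
    for h :: "'u \<Rightarrow> real" and u
  proof -
    \<comment> \<open>Level sets of \<open>h\<close> are measurable, so \<open>h\<close> is constant
      on atoms and may be evaluated at the representative.\<close>
    have "{v \<in> space U. h v = h u} \<in> sets U" using h by measurable
    from least[OF this] u rep[of u] have r: "rep u \<in> space U" "h (rep u) = h u" by auto
    have "(\<Sum>v\<in>space U. w v u * h v) = (\<Sum>v\<in>space U. if v = rep u then h v else 0)"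
      by (intro sum.cong) (auto simp: w_def u)
    then show ?thesis using r fin by (simp add: sum.delta')
  qed
qed

context observed_system
begin

lemma decisions_measurable:
  "admissible M T Y U u \<Longrightarrow> k \<ge> 1 \<Longrightarrow> u k \<in> measurable (obs {0..int k}) U"
  by (auto simp: admissible_def decisions_def)

context
  fixes U :: "'u measure" and l :: "'u \<Rightarrow> 'a \<Rightarrow> real" and \<Lambda> :: "'a \<Rightarrow> real"
  assumes l: "(\<lambda>(u, \<omega>). l u \<omega>) \<in> borel_measurable (U \<Otimes>\<^sub>M M)"
    and fin: "finite (space U)"
    and \<Lambda>: "integrable M \<Lambda>" "\<And>u \<omega>. u \<in> space U \<Longrightarrow> \<omega> \<in> space M \<Longrightarrow> \<bar>l u \<omega>\<bar> \<le> \<Lambda> \<omega>"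
begin

lemma integrable_loss_at:
  assumes u: "u \<in> measurable (obs K) U"
  shows "integrable M (loss_at M T l k u)"
proof (rule Bochner_Integration.integrable_bound[OF integrable_tp[OF \<Lambda>(1), of k]])
  have uM: "u \<in> measurable M U" by (rule measurable_from_subalg[OF subalgebra_obs u])
  have "(\<lambda>\<omega>. (\<lambda>(u, \<omega>). l u \<omega>) (u \<omega>, tp k \<omega>)) \<in> borel_measurable M"
    by (rule measurable_compose[OF _ l]) (intro measurable_Pair uM tp_measurable)
  then show "loss_at M T l k u \<in> borel_measurable M" by (simp add: loss_at_def[abs_def])
  show "AE \<omega> in M. norm (loss_at M T l k u \<omega>) \<le> norm (\<Lambda> (tp k \<omega>))"
  proof (rule AE_I2)
    fix \<omega> assume "\<omega> \<in> space M"
    then have "\<bar>l (u \<omega>) (tp k \<omega>)\<bar> \<le> \<Lambda> (tp k \<omega>)"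
      by (intro \<Lambda>(2) measurable_space[OF uM] tp_space)
    then show "norm (loss_at M T l k u \<omega>) \<le> norm (\<Lambda> (tp k \<omega>))" by (simp add: loss_at_def)
  qed
qed

lemma avg_loss_cond_loss_L1:
  assumes wm: "cond_weak_mixing M T (obs {..0})" and u: "admissible M T Y U u"
  shows "(\<lambda>N. \<integral>x. \<bar>1 / real N * (\<Sum>k=1..N. loss_at M T l (int k) (u k) x - cond_loss M T Y l k (u k) x)\<bar> \<partial>M)
    \<longlonglongrightarrow> 0"
proof -
  obtain w :: "'u \<Rightarrow> 'u \<Rightarrow> real" where w: "\<And>v. w v \<in> borel_measurable U" "\<And>v u. \<bar>w v u\<bar> \<le> 1"
    "\<And>(h :: 'u \<Rightarrow> real) u. h \<in> borel_measurable U \<Longrightarrow> u \<in> space U \<Longrightarrow> h u = (\<Sum>v\<in>space U. w v u * h v)"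
    by (rule finite_space_measurable_weights[OF fin]) (rule that)
  note uk = decisions_measurable[OF u]
  have ukM: "u k \<in> measurable M U" if "k \<ge> 1" for k
    by (rule measurable_from_subalg[OF subalgebra_obs uk[OF that]])
  have wk: "(\<lambda>x. w v (u k x)) \<in> borel_measurable (obs {0..int k})" if "k \<ge> 1" for v k
    by (rule measurable_compose[OF uk[OF that] w(1)])
  have wkM: "(\<lambda>x. w v (u k x)) \<in> borel_measurable M" if "k \<ge> 1" for v k
    by (rule measurable_from_subalg[OF subalgebra_obs wk[OF that]])
  \<comment> \<open>The value 0 outside \<open>space U\<close> makes \<open>f v\<close> integrable
    for every \<open>v\<close>; the sums run over \<open>space U\<close> and never see it.\<close>
  define f where "f v = (if v \<in> space U then l v else (\<lambda>_. 0))" for v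
  have f: "integrable M (f v)" for v
  proof (cases "v \<in> space U")
    case True
    \<comment> \<open>A fixed decision is measurable even for the trivial field, generated by the
      empty set of times.\<close>
    have "integrable M (loss_at M T l 0 (\<lambda>_. v))"
      by (rule integrable_loss_at[of _ "{}"]) (use True in auto)
    then show ?thesis using True by (simp add: loss_at_def[abs_def] f_def)
  qed (simp add: f_def)
  note ftp = integrable_tp[OF f]
  have wint: "integrable M (\<lambda>x. w v (u k x) * h x)" if "k \<ge> 1" "integrable M h" for h v k
    by (rule integrable_bounded_mult[OF wkM]) (use that w(2) in auto)
  have loss_eq: "loss_at M T l (int k) (u k) x = (\<Sum>v\<in>space U. w v (u k x) * f v (tp (int k) x))"
    if "k \<ge> 1" "x \<in> space M" for k x
  proof -
    have "(\<lambda>v. l v (tp (int k) x)) \<in> borel_measurable U"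
      using measurable_compose[OF measurable_Pair2'[of "tp (int k) x" M U] l] that(2) by simp
    from w(3)[OF this measurable_space[OF ukM[OF that(1)] that(2)]]
    show ?thesis unfolding loss_at_def by (simp add: f_def)
  qed
  define E where "E v k = real_cond_exp M (obs {0..int k}) (\<lambda>x. f v (tp (int k) x))" for v k
  have iE: "integrable M (E v k)" for v k
    unfolding E_def
    by (rule sigma_finite_subalgebra.real_cond_exp_int[OF sigma_finite_subalgebraI[OF subalgebra_obs] ftp])
  have cond_eq: "AE x in M. cond_loss M T Y l k (u k) x = (\<Sum>v\<in>space U. w v (u k x) * E v k x)"
    if k: "k \<ge> 1" for k
  proof -
    interpret sigma_finite_subalgebra M "obs {0..int k}" by (rule sigma_finite_subalgebraI[OF subalgebra_obs])
    note i = wint[OF k ftp[of _ "int k"]]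
    have "AE x in M. cond_loss M T Y l k (u k) x
        = real_cond_exp M (obs {0..int k}) (\<lambda>x. \<Sum>v\<in>space U. w v (u k x) * f v (tp (int k) x)) x"
      unfolding cond_loss_def
    proof (rule real_cond_exp_cong)
      show "AE x in M. loss_at M T l (int k) (u k) x = (\<Sum>v\<in>space U. w v (u k x) * f v (tp (int k) x))"
        using loss_eq[OF k] by auto
      show "loss_at M T l (int k) (u k) \<in> borel_measurable M"
        using integrable_loss_at[OF uk[OF k]] by auto
      show "(\<lambda>x. \<Sum>v\<in>space U. w v (u k x) * f v (tp (int k) x)) \<in> borel_measurable M"
        by (intro borel_measurable_sum borel_measurable_integrable[OF i])
    qed
    moreover have "AE x in M. real_cond_exp M (obs {0..int k}) (\<lambda>x. \<Sum>v\<in>space U. w v (u k x) * f v (tp (int k) x)) x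
        = (\<Sum>v\<in>space U. real_cond_exp M (obs {0..int k}) (\<lambda>x. w v (u k x) * f v (tp (int k) x)) x)"
      by (rule real_cond_exp_sum[OF i])
    moreover have "AE x in M. \<forall>v\<in>space U. real_cond_exp M (obs {0..int k}) (\<lambda>x. w v (u k x) * f v (tp (int k) x)) x
        = w v (u k x) * E v k x"
      unfolding E_def
      by (intro AE_finite_allI fin real_cond_exp_mult wk[OF k] i borel_measurable_integrable[OF ftp])
    ultimately show ?thesis by eventually_elim simp
  qed
  define S where "S v N x = 1 / real N * (\<Sum>k=1..N. w v (u k x) * (f v (tp (int k) x) - E v k x))" for v N x
  have iS: "integrable M (S v N)" for v N
    unfolding S_def[abs_def]
    by (intro integrable_mult_right Bochner_Integration.integrable_sum wint
        Bochner_Integration.integrable_diff ftp iE) auto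
  have S0: "(\<lambda>N. \<integral>x. \<bar>S v N x\<bar> \<partial>M) \<longlonglongrightarrow> 0" for v
    unfolding S_def E_def by (rule adapted_average_L1[OF wm wk w(2) f])
  let ?D = "\<lambda>N x. 1 / real N * (\<Sum>k=1..N. loss_at M T l (int k) (u k) x - cond_loss M T Y l k (u k) x)"
  have "(\<integral>x. \<bar>?D N x\<bar> \<partial>M) \<le> (\<Sum>v\<in>space U. \<integral>x. \<bar>S v N x\<bar> \<partial>M)" for N
  proof -
    have "AE x in M. \<forall>k. 1 \<le> k \<longrightarrow> cond_loss M T Y l k (u k) x = (\<Sum>v\<in>space U. w v (u k x) * E v k x)"
      unfolding AE_all_countable using cond_eq by auto
    with AE_space have le: "AE x in M. \<bar>?D N x\<bar> \<le> (\<Sum>v\<in>space U. \<bar>S v N x\<bar>)"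
    proof eventually_elim
      case (elim x)
      have "?D N x = 1 / real N * (\<Sum>k=1..N. \<Sum>v\<in>space U. w v (u k x) * (f v (tp (int k) x) - E v k x))"
      proof (rule arg_cong[where f = "\<lambda>y. 1 / real N * y"], rule sum.cong[OF refl])
        fix k assume k: "k \<in> {1..N}"
        have "loss_at M T l (int k) (u k) x = (\<Sum>v\<in>space U. w v (u k x) * f v (tp (int k) x))"
          by (rule loss_eq) (use k elim(1) in auto)
        moreover have "cond_loss M T Y l k (u k) x = (\<Sum>v\<in>space U. w v (u k x) * E v k x)"
          using elim(2) k by auto
        ultimately show "loss_at M T l (int k) (u k) x - cond_loss M T Y l k (u k) x
            = (\<Sum>v\<in>space U. w v (u k x) * (f v (tp (int k) x) - E v k x))"
          by (simp only: sum_subtractf right_diff_distrib)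
      qed
      also have "\<dots> = (\<Sum>v\<in>space U. S v N x)"
        unfolding S_def by (subst sum.swap) (simp only: sum_distrib_left)
      finally show ?case using sum_abs[of "\<lambda>v. S v N x" "space U"] by simp
    qed
    have iD: "integrable M (?D N)"
      unfolding cond_loss_def
      by (intro integrable_mult_right Bochner_Integration.integrable_sum Bochner_Integration.integrable_diff
          sigma_finite_subalgebra.real_cond_exp_int[OF sigma_finite_subalgebraI[OF subalgebra_obs]]
          integrable_loss_at[OF uk]) auto
    have "(\<integral>x. \<bar>?D N x\<bar> \<partial>M) \<le> (\<integral>x. (\<Sum>v\<in>space U. \<bar>S v N x\<bar>) \<partial>M)"
      by (rule integral_mono_AE[OF _ _ le])
        (intro integrable_abs iD Bochner_Integration.integrable_sum iS)+
    also have "\<dots> = (\<Sum>v\<in>space U. \<integral>x. \<bar>S v N x\<bar> \<partial>M)"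
      by (intro Bochner_Integration.integral_sum integrable_abs iS)
    finally show ?thesis .
  qed
  moreover have "(\<lambda>N. \<Sum>v\<in>space U. \<integral>x. \<bar>S v N x\<bar> \<partial>M) \<longlonglongrightarrow> 0"
    using tendsto_sum[of "space U" "\<lambda>v N. \<integral>x. \<bar>S v N x\<bar> \<partial>M" "\<lambda>_. 0" sequentially] S0 by simp
  ultimately show ?thesis
    by (rule tendsto_zero_squeeze[rotated]) simp_all
qed

lemma mean_optimal_cond_loss_le:
  assumes opt: "mean_optimal M T Y U l ut" and u: "admissible M T Y U u" and k: "k \<ge> 1"
  shows "AE x in M. cond_loss M T Y l k (ut k) x \<le> cond_loss M T Y l k (u k) x + 1 / real k"
proof -
  let ?F = "{\<lambda>\<omega>'. ereal (cond_loss M T Y l k u \<omega>') | u. u \<in> decisions M T Y U 0 (int k)}"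
  \<comment> \<open>Since \<open>ess_inf\<close> is a choice, its lower bound property is available
    once an essential infimum exists, which measurability of the family guarantees.\<close>
  have "?F \<subseteq> borel_measurable M" by (auto simp: cond_loss_def)
  from is_ess_inf_ess_inf[OF finite_measure_axioms this]
  have "\<forall>f\<in>?F. AE x in M. ess_inf M ?F x \<le> f x"
    unfolding is_ess_inf_def by (elim conjE)
  moreover have "(\<lambda>x. ereal (cond_loss M T Y l k (u k) x)) \<in> ?F"
    using u k by (intro CollectI exI[of _ "u k"] conjI refl) (simp add: admissible_def)
  ultimately have "AE x in M. ess_inf M ?F x \<le> ereal (cond_loss M T Y l k (u k) x)" by (rule bspec)
  moreover have "AE x in M. ereal (cond_loss M T Y l k (ut k) x) \<le> ess_inf M ?F x + ereal (1 / real k)"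
    using opt k by (simp only: mean_optimal_def)
  ultimately show ?thesis
  proof eventually_elim
    case (elim x)
    have "ereal (cond_loss M T Y l k (ut k) x) \<le> ereal (cond_loss M T Y l k (u k) x) + ereal (1 / real k)"
      using elim(2) add_right_mono[OF elim(1)] by (rule order_trans)
    then show ?case by simp
  qed
qed

text \<open>Both time averages are replaced by their conditional versions at a cost that is small in
  L1. Conditional losses compare at each time up to 1/k, a tolerance with vanishing Cesaro mean, and
  Markov's inequality turns the L1 estimate into one in probability.\<close>

lemma mean_optimal_weakly_pathwise_optimal:
  assumes wm: "cond_weak_mixing M T (obs {..0})" and opt: "mean_optimal M T Y U l ut"
  shows "weakly_pathwise_optimal M T Y U l ut"
  unfolding weakly_pathwise_optimal_def
proof (intro conjI allI impI)
  show ut: "admissible M T Y U ut" using opt by (simp add: mean_optimal_def)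
  fix u and \<epsilon> :: real assume u: "admissible M T Y U u" and \<epsilon>: "0 < \<epsilon>"
  define D where "D u N x = 1 / real N * (\<Sum>k=1..N. loss_at M T l (int k) (u k) x - cond_loss M T Y l k (u k) x)" for u N x
  \<comment> \<open>A majorant of the amount by which \<open>ut\<close> can lose to
    \<open>u\<close>: the two deviations from the conditional losses plus the averaged
    tolerances.\<close>
  define W where "W N x = \<bar>D u N x\<bar> + \<bar>D ut N x\<bar> + 1 / real N * (\<Sum>k=1..N. 1 / real k)" for N x
  have iD: "integrable M (D u N)" if "admissible M T Y U u" for u N
    unfolding cond_loss_def D_def[abs_def]
    by (intro integrable_mult_right Bochner_Integration.integrable_sum Bochner_Integration.integrable_diff
        sigma_finite_subalgebra.real_cond_exp_int[OF sigma_finite_subalgebraI[OF subalgebra_obs]]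
        integrable_loss_at[OF decisions_measurable[OF that]]) auto
  have iW: "integrable M (W N)" for N
    unfolding W_def[abs_def] using iD[OF u] iD[OF ut] by auto
  have W0: "0 \<le> W N x" for N x by (simp add: W_def sum_nonneg)
  have "(\<lambda>N. (\<integral>x. \<bar>D u N x\<bar> \<partial>M) + (\<integral>x. \<bar>D ut N x\<bar> \<partial>M) + 1 / real N * (\<Sum>k=1..N. 1 / real k)) \<longlonglongrightarrow> 0"
    unfolding D_def
    by (intro tendsto_add_zero avg_loss_cond_loss_L1[OF wm] u ut cesaro_mean_tendsto_zero lim_1_over_n)
  also have "(\<lambda>N. (\<integral>x. \<bar>D u N x\<bar> \<partial>M) + (\<integral>x. \<bar>D ut N x\<bar> \<partial>M) + 1 / real N * (\<Sum>k=1..N. 1 / real k))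
      = (\<lambda>N. \<integral>x. W N x \<partial>M)"
    unfolding W_def using iD[OF u] iD[OF ut] by (simp add: prob_space)
  finally have W_lim: "(\<lambda>N. (\<integral>x. W N x \<partial>M) / \<epsilon>) \<longlonglongrightarrow> 0"
    by (rule tendsto_divide_zero)
  have loss_ge: "AE x in M. - W N x \<le> avg_loss M T l u N x - avg_loss M T l ut N x" for N
  proof -
    have "AE x in M. \<forall>k. 1 \<le> k \<longrightarrow> cond_loss M T Y l k (ut k) x \<le> cond_loss M T Y l k (u k) x + 1 / real k"
      unfolding AE_all_countable using mean_optimal_cond_loss_le[OF opt u] by auto
    then show ?thesis
    proof eventually_elim
      case (elim x)
      have "(\<Sum>k=1..N. cond_loss M T Y l k (ut k) x) \<le> (\<Sum>k=1..N. cond_loss M T Y l k (u k) x + 1 / real k)"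
        by (rule sum_mono) (use elim in auto)
      then have "1 / real N * (\<Sum>k=1..N. cond_loss M T Y l k (ut k) x)
          \<le> 1 / real N * (\<Sum>k=1..N. cond_loss M T Y l k (u k) x + 1 / real k)"
        by (rule mult_left_mono) simp
      then have "D u N x - D ut N x - 1 / real N * (\<Sum>k=1..N. 1 / real k)
          \<le> avg_loss M T l u N x - avg_loss M T l ut N x"
        unfolding D_def avg_loss_def sum_subtractf sum.distrib right_diff_distrib distrib_left by linarith
      then show ?case unfolding W_def by linarith
    qed
  qed
  let ?G = "\<lambda>N. {x \<in> space M. avg_loss M T l u N x - avg_loss M T l ut N x \<ge> - \<epsilon>}"
  have avgM: "avg_loss M T l u N \<in> borel_measurable M" if "admissible M T Y U u" for u N
    unfolding avg_loss_def[abs_def]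
    by (intro borel_measurable_times borel_measurable_const borel_measurable_sum
        borel_measurable_integrable[OF integrable_loss_at[OF decisions_measurable[OF that]]]) auto
  note [measurable] = avgM[OF u] avgM[OF ut] borel_measurable_integrable[OF iW]
  have "1 - measure M (?G N) \<le> (\<integral>x. W N x \<partial>M) / \<epsilon>" for N
  proof -
    have "1 - measure M (?G N) = measure M (space M - ?G N)"
      by (rule prob_compl[symmetric]) measurable
    \<comment> \<open>A loss difference below -\<epsilon> forces W above \<epsilon>, outside the
      null set where the comparison of conditional losses fails.\<close>
    also have "\<dots> \<le> measure M {x \<in> space M. W N x \<ge> \<epsilon>}"
    proof (rule finite_measure_mono_AE)
      show "AE x in M. x \<in> space M - ?G N \<longrightarrow> x \<in> {x \<in> space M. W N x \<ge> \<epsilon>}"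
        using loss_ge[of N] by eventually_elim auto
    qed measurable
    also have "\<dots> \<le> (\<integral>x. W N x \<partial>M) / \<epsilon>"
      by (rule integral_Markov_inequality_measure[where A = "{}"]) (use iW W0 \<epsilon> in auto)
    finally show ?thesis .
  qed
  then have "(\<lambda>N. 1 - measure M (?G N)) \<longlonglongrightarrow> 0"
    by (intro tendsto_zero_squeeze[OF _ _ W_lim]) auto
  from tendsto_diff[OF tendsto_const[of 1] this]
  show "(\<lambda>N. measure M (?G N)) \<longlonglongrightarrow> 1" by simp
qed

end

end

theorem theorem1p8:
  fixes M :: "'a measure" and Y :: "'a measure" and T :: "'a \<Rightarrow> 'a"
    and U :: "'u measure" and l :: "'u \<Rightarrow> 'a \<Rightarrow> real" and \<Lambda> :: "'a \<Rightarrow> real"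
    and ut :: "nat \<Rightarrow> 'a \<Rightarrow> 'u"
  assumes "prob_space M"
    and "invertible_mp M T"
    and "ergodic M T"
    and "subalgebra M Y"
    and "cond_weak_mixing M T (obs_field M T Y {..0})"
    and "(\<lambda>(u, \<omega>). l u \<omega>) \<in> borel_measurable (U \<Otimes>\<^sub>M M)"
    and "finite (space U)"
    and "integrable M \<Lambda>"
    and "\<And>u \<omega>. u \<in> space U \<Longrightarrow> \<omega> \<in> space M \<Longrightarrow> \<bar>l u \<omega>\<bar> \<le> \<Lambda> \<omega>"
    and "mean_optimal M T Y U l ut"
  shows "weakly_pathwise_optimal M T Y U l ut"
proof -
  interpret observed_system M T Y
    using assms by (intro observed_system.intro observed_system_axioms.intro)
  show ?thesis
    by (rule mean_optimal_weakly_pathwise_optimal[OF assms(6-9,5,10)])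
qed

end
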